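(* Let $\kappa$ be a field and $D_\infty=\langle a,b\mid b^2=1,\ ba=a^{-1}b\rangle$ the infinite dihedral group. Let $pm'(D_\infty)$ be the subsemigroup of $pm(D_\infty)$ of all factor sets $\sigma$ such that $\sigma(g,g^{-1})\in\{0,1\}$ for all $g\in D_\infty$. Then there is a surjective map of semigroups $$\{0,1\}^{\mathbb{Z}^+\sqcup\mathbb{Z}}\times\kappa^{\mathbb{Z}^+\times\mathbb{Z}^+\sqcup\mathbb{Z}^+\times\mathbb{Z}}\to pm'(D_\infty).$$ Furthermore, for every $\sigma\in pm'(D_\infty)$ there exist unique $\nu:\mathbb{Z}^+\sqcup\mathbb{Z}\to\{0,1\}$ and $\omega:\mathbb{Z}^+\times\mathbb{Z}^+\sqcup\mathbb{Z}^+\times\mathbb{Z}\to\kappa$ such that $\sigma=\sigma_\nu\sigma_\omega$ and $\operatorname{Null}(\sigma_\nu)\cap\operatorname{Null}(\sigma_\omega)=\varnothing$.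
   Context: A partial projective $\sigma$-representation of a group $G$ in a unital (associative) $\kappa$-algebra $R$ (with $1_R\neq 0$) is a map $\Gamma:G\to R$ for which there is a function $\sigma:G\times G\to\kappa$ (called the factor set) such that for all $g,h\in G$: (i) if $\sigma(g,h)=0$ then $\Gamma(g^{-1})\Gamma(gh)=0$ and $\Gamma(gh)\Gamma(h^{-1})=0$; (ii) if $\Gamma(g)\Gamma(h)=0$ then $\sigma(g,h)=0$; (iii) $\Gamma(1_G)=1_R$; (iv) $\Gamma(g^{-1})\Gamma(g)\Gamma(h)=\sigma(g,h)\Gamma(g^{-1})\Gamma(gh)$; (v) $\Gamma(g)\Gamma(h)\Gamma(h^{-1})=\sigma(g,h)\Gamma(gh)\Gamma(h^{-1})$. The set of all factor sets of $G$ (over all such $R$ and $\Gamma$) is $pm(G)$, a semigroup under pointwise multiplication. $\operatorname{Null}(\sigma)=\{(x,y):\sigma(x,y)=0\}$. $\mathbb{Z}^+$ is the set of positive integers; sets of functions into $\{0,1\}$ or $\kappa$ are semigroups under pointwise multiplication, and pairs are multiplied componentwise. For $\nu=(\nu_0,\nu_1)$ with $\nu_0:\mathbb{Z}^+\to\{0,1\}$, $\nu_1:\mathbb{Z}\to\{0,1\}$, put $S_\nu=\{a^i,a^{-i}:i\in\mathbb{Z}^+,\nu_0(i)=0\}\cup\{ba^i:i\in\mathbb{Z},\nu_1(i)=0\}$ and let $\sigma_\nu(x,y)=0$ if $\{x,y,xy\}\cap S_\nu\neq\varnothing$, $\sigma_\nu(x,y)=1$ otherwise. For $x,y\in D_\infty$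 let $C_{(x,y)}:=\{(x,y),(y^{-1}x^{-1},x),(y,y^{-1}x^{-1}),(y^{-1},x^{-1}),(x^{-1},xy),(xy,y^{-1})\}$. The pairs $(a^n,a^m)$ with $(n,m)\in\mathbb{Z}^+\times\mathbb{Z}^+$ together with the pairs $(a^i,ba^j)$ with $(i,j)\in\mathbb{Z}^+\times\mathbb{Z}$ form a system of representatives of the sets $C_{(x,y)}$ with $x\neq1$, $y\neq1$, $x\neq y^{-1}$, each such set having six distinct elements. For $\omega=(\omega_0,\omega_1)$ with $\omega_0:\mathbb{Z}^+\times\mathbb{Z}^+\to\kappa$, $\omega_1:\mathbb{Z}^+\times\mathbb{Z}\to\kappa$, define $\sigma_\omega:D_\infty\times D_\infty\to\kappa$ by: $\sigma_\omega(x,y)=1$ if $x=1$ or $y=1$ or $xy=1$; and for each representative $(x,y)=(a^n,a^m)$ (with $c=\omega_0(n,m)$) or $(x,y)=(a^i,ba^j)$ (with $c=\omega_1(i,j)$), $\sigma_\omega$ takes the value $c$ on $(x,y)$, $(y,y^{-1}x^{-1})$, $(y^{-1}x^{-1},x)$, and on $(y^{-1},x^{-1})$, $(x^{-1},xy)$, $(xy,y^{-1})$ it takes the value $c^{-1}$ if $c\neq0$ and $0$ if $c=0$.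
   Formalization: Uniqueness of ω is stated only at the representatives (x,y) outside Null(σ_ν); ν is fully unique. Over fields with more than two elements ω is not unique as claimed: for σ(1,1)=1 and σ=0 elsewhere, ν=0 and every nowhere-zero ω works. *)

theory Defs
  imports "HOL-Algebra.Module" "HOL-Algebra.Product_Groups"
begin

section \<open>Partial projective representations and their factor sets\<close>

text \<open>The locale \<open>algebra\<close> of HOL-Algebra only covers commutative algebras.\<close>

locale unital_assoc_algebra = module K R + R?: ring R for K (structure) and R (structure) +
  assumes smult_mult_left:
    "\<lbrakk>c \<in> carrier K; x \<in> carrier R; y \<in> carrier R\<rbrakk>
      \<Longrightarrow> (c \<odot>\<^bsub>R\<^esub> x) \<otimes>\<^bsub>R\<^esub> y = c \<odot>\<^bsub>R\<^esub> (x \<otimes>\<^bsub>R\<^esub> y)"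
  and smult_mult_right:
    "\<lbrakk>c \<in> carrier K; x \<in> carrier R; y \<in> carrier R\<rbrakk>
      \<Longrightarrow> x \<otimes>\<^bsub>R\<^esub> (c \<odot>\<^bsub>R\<^esub> y) = c \<odot>\<^bsub>R\<^esub> (x \<otimes>\<^bsub>R\<^esub> y)"
  and one_neq_zero: "\<one>\<^bsub>R\<^esub> \<noteq> \<zero>\<^bsub>R\<^esub>"

definition partial_proj_rep ::
  "('k, 'm) ring_scheme \<Rightarrow> ('g, 'n) monoid_scheme \<Rightarrow> ('k, 'r, 'p) module_scheme
    \<Rightarrow> ('g \<Rightarrow> 'r) \<Rightarrow> ('g \<times> 'g \<Rightarrow> 'k) \<Rightarrow> bool" where
  "partial_proj_rep K G R \<Gamma> \<sigma> \<longleftrightarrow>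
    \<Gamma> \<in> carrier G \<rightarrow> carrier R \<and>
    \<sigma> \<in> carrier G \<times> carrier G \<rightarrow> carrier K \<and>
    (\<forall>g\<in>carrier G. \<forall>h\<in>carrier G.
      (\<sigma> (g, h) = \<zero>\<^bsub>K\<^esub> \<longrightarrow>
        \<Gamma> (inv\<^bsub>G\<^esub> g) \<otimes>\<^bsub>R\<^esub> \<Gamma> (g \<otimes>\<^bsub>G\<^esub> h) = \<zero>\<^bsub>R\<^esub> \<and>
        \<Gamma> (g \<otimes>\<^bsub>G\<^esub> h) \<otimes>\<^bsub>R\<^esub> \<Gamma> (inv\<^bsub>G\<^esub> h) = \<zero>\<^bsub>R\<^esub>) \<and>
      (\<Gamma> g \<otimes>\<^bsub>R\<^esub> \<Gamma> h = \<zero>\<^bsub>R\<^esub> \<longrightarrow> \<sigma> (g, h) = \<zero>\<^bsub>K\<^esub>) \<and>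
      \<Gamma> (inv\<^bsub>G\<^esub> g) \<otimes>\<^bsub>R\<^esub> \<Gamma> g \<otimes>\<^bsub>R\<^esub> \<Gamma> h
        = \<sigma> (g, h) \<odot>\<^bsub>R\<^esub> (\<Gamma> (inv\<^bsub>G\<^esub> g) \<otimes>\<^bsub>R\<^esub> \<Gamma> (g \<otimes>\<^bsub>G\<^esub> h)) \<and>
      \<Gamma> g \<otimes>\<^bsub>R\<^esub> \<Gamma> h \<otimes>\<^bsub>R\<^esub> \<Gamma> (inv\<^bsub>G\<^esub> h)
        = \<sigma> (g, h) \<odot>\<^bsub>R\<^esub> (\<Gamma> (g \<otimes>\<^bsub>G\<^esub> h) \<otimes>\<^bsub>R\<^esub> \<Gamma> (inv\<^bsub>G\<^esub> h))) \<and>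
    \<Gamma> \<one>\<^bsub>G\<^esub> = \<one>\<^bsub>R\<^esub>"

text \<open>
  HOL cannot quantify existentially over the type of the elements of \<open>R\<close>. It suffices to let
  the carrier of \<open>R\<close> range over the subsets of one type that is large enough: the subalgebra
  generated by the range of \<open>\<Gamma>\<close> consists of values of the following formal expressions.
  Lemma \<open>factor_set_in_pm\<close> below shows that the resulting set of factor sets contains those of
  representations in algebras over arbitrary types.
\<close>

datatype ('g, 'k) alg_expr =
  Gen 'g | Scalar 'k | Plus "('g, 'k) alg_expr" "('g, 'k) alg_expr"
  | Times "('g, 'k) alg_expr" "('g, 'k) alg_expr"

definition pm :: "('k, 'm) ring_scheme \<Rightarrow> ('g, 'n) monoid_scheme \<Rightarrow> ('g \<times> 'g \<Rightarrow> 'k) set" where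
  "pm K G = {\<sigma> \<in> carrier G \<times> carrier G \<rightarrow>\<^sub>E carrier K.
     \<exists>(R :: ('k, ('g, 'k) alg_expr) module) \<Gamma>.
       unital_assoc_algebra K R \<and> partial_proj_rep K G R \<Gamma> \<sigma>}"

definition pm' :: "('k, 'm) ring_scheme \<Rightarrow> ('g, 'n) monoid_scheme \<Rightarrow> ('g \<times> 'g \<Rightarrow> 'k) set" where
  "pm' K G = {\<sigma> \<in> pm K G. \<forall>g\<in>carrier G. \<sigma> (g, inv\<^bsub>G\<^esub> g) \<in> {\<zero>\<^bsub>K\<^esub>, \<one>\<^bsub>K\<^esub>}}"

definition Null :: "('k, 'm) ring_scheme \<Rightarrow> ('g, 'n) monoid_scheme \<Rightarrow> ('g \<times> 'g \<Rightarrow> 'k)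
    \<Rightarrow> ('g \<times> 'g) set" where
  "Null K G \<sigma> = {(x, y) \<in> carrier G \<times> carrier G. \<sigma> (x, y) = \<zero>\<^bsub>K\<^esub>}"

text \<open>Despite its name, \<^const>\<open>product_group\<close> is just the pointwise product on functions.\<close>

definition maps_monoid ::
  "('k, 'm) ring_scheme \<Rightarrow> ('g, 'n) monoid_scheme \<Rightarrow> ('g \<times> 'g \<Rightarrow> 'k) monoid" where
  "maps_monoid K G = product_group (carrier G \<times> carrier G) (\<lambda>_. K)"

definition pm'_semigroup ::
  "('k, 'm) ring_scheme \<Rightarrow> ('g, 'n) monoid_scheme \<Rightarrow> ('g \<times> 'g \<Rightarrow> 'k) monoid" where
  "pm'_semigroup K G = (maps_monoid K G)\<lparr>carrier := pm' K G\<rparr>"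


subsection \<open>Independence of the type of the algebra\<close>

primrec alg_eval :: "('k, 'r, 'p) module_scheme \<Rightarrow> ('g \<Rightarrow> 'r) \<Rightarrow> ('g, 'k) alg_expr \<Rightarrow> 'r" where
  "alg_eval R \<Gamma> (Gen g) = \<Gamma> g"
| "alg_eval R \<Gamma> (Scalar c) = c \<odot>\<^bsub>R\<^esub> \<one>\<^bsub>R\<^esub>"
| "alg_eval R \<Gamma> (Plus s t) = alg_eval R \<Gamma> s \<oplus>\<^bsub>R\<^esub> alg_eval R \<Gamma> t"
| "alg_eval R \<Gamma> (Times s t) = alg_eval R \<Gamma> s \<otimes>\<^bsub>R\<^esub> alg_eval R \<Gamma> t"

lemma factor_set_in_pm:
  fixes K :: "('k, 'm) ring_scheme" and G :: "('g, 'n) monoid_scheme"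
    and R :: "('k, 'r, 'p) module_scheme"
  assumes G: "group G" and R: "unital_assoc_algebra K R"
    and rep: "partial_proj_rep K G R \<Gamma> \<sigma>"
    and ext: "\<sigma> \<in> extensional (carrier G \<times> carrier G)"
  shows "\<sigma> \<in> pm K G"
proof -
  interpret G: group G by (rule G)
  interpret R: unital_assoc_algebra K R by (rule R)
  have \<Gamma>: "\<Gamma> g \<in> carrier R" if "g \<in> carrier G" for g
    using rep that by (auto simp: partial_proj_rep_def)
  have \<sigma>: "\<sigma> (g, h) \<in> carrier K" if "g \<in> carrier G" "h \<in> carrier G" for g h
    using rep that by (auto simp: partial_proj_rep_def)
  define V where "V = {t :: ('g, 'k) alg_expr. set1_alg_expr t \<subseteq> carrier G \<and> set2_alg_expr t \<subseteq> carrier K}"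
  define e where "e = alg_eval R \<Gamma>"
  define A where "A = e ` V"
  define s where "s = inv_into V e"
  have eV: "e t \<in> carrier R" if "t \<in> V" for t
    using that unfolding V_def e_def by (induction t) (auto intro: \<Gamma>)
  have A_sub: "A \<subseteq> carrier R" using eV by (auto simp: A_def)
  have A_\<Gamma>: "\<Gamma> g \<in> A" if "g \<in> carrier G" for g
    unfolding A_def by (rule image_eqI[of _ _ "Gen g"]) (auto simp: e_def V_def that)
  have A_scalar: "c \<odot>\<^bsub>R\<^esub> \<one>\<^bsub>R\<^esub> \<in> A" if "c \<in> carrier K" for c
    unfolding A_def by (rule image_eqI[of _ _ "Scalar c"]) (auto simp: e_def V_def that)
  have A_add: "x \<oplus>\<^bsub>R\<^esub> y \<in> A" if xy: "x \<in> A" "y \<in> A" for x y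
  proof -
    obtain p q where "p \<in> V" "q \<in> V" "x = e p" "y = e q" using xy by (auto simp: A_def)
    then show ?thesis
      unfolding A_def by (intro image_eqI[of _ _ "Plus p q"]) (auto simp: e_def V_def)
  qed
  have A_mult: "x \<otimes>\<^bsub>R\<^esub> y \<in> A" if xy: "x \<in> A" "y \<in> A" for x y
  proof -
    obtain p q where "p \<in> V" "q \<in> V" "x = e p" "y = e q" using xy by (auto simp: A_def)
    then show ?thesis
      unfolding A_def by (intro image_eqI[of _ _ "Times p q"]) (auto simp: e_def V_def)
  qed
  have A_smult: "c \<odot>\<^bsub>R\<^esub> x \<in> A" if "c \<in> carrier K" "x \<in> A" for c x
  proof -
    have "c \<odot>\<^bsub>R\<^esub> x = (c \<odot>\<^bsub>R\<^esub> \<one>\<^bsub>R\<^esub>) \<otimes>\<^bsub>R\<^esub> x"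
      using that A_sub by (subst R.smult_mult_left) auto
    then show ?thesis using A_mult[OF A_scalar] that by simp
  qed
  have A_one: "\<one>\<^bsub>R\<^esub> \<in> A" using A_scalar[of "\<one>\<^bsub>K\<^esub>"] by simp
  have A_zero: "\<zero>\<^bsub>R\<^esub> \<in> A" using A_smult[OF _ A_one, of "\<zero>\<^bsub>K\<^esub>"] by simp
  have es [simp]: "e (s x) = x" if "x \<in> A" for x
    using that unfolding A_def s_def by (rule f_inv_into_f)
  have s_inj: "s x = s y \<longleftrightarrow> x = y" if "x \<in> A" "y \<in> A" for x y
    using that es by metis
  define R' :: "('k, ('g, 'k) alg_expr) module" where
    "R' = \<lparr>carrier = s ` A, mult = (\<lambda>x y. s (e x \<otimes>\<^bsub>R\<^esub> e y)), one = s \<one>\<^bsub>R\<^esub>,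
       zero = s \<zero>\<^bsub>R\<^esub>, add = (\<lambda>x y. s (e x \<oplus>\<^bsub>R\<^esub> e y)),
       smult = (\<lambda>c x. s (c \<odot>\<^bsub>R\<^esub> e x))\<rparr>"
  note A_in = subsetD[OF A_sub]
  have ring: "ring R'"
  proof (rule ringI)
    show "abelian_group R'"
    proof (rule abelian_groupI)
      fix x assume "x \<in> carrier R'"
      then obtain u where u: "u \<in> A" "x = s u" by (auto simp: R'_def)
      have "\<ominus>\<^bsub>R\<^esub> u = (\<ominus>\<^bsub>K\<^esub> \<one>\<^bsub>K\<^esub>) \<odot>\<^bsub>R\<^esub> u" using u A_in by (simp add: R.smult_l_minus)
      then have m: "\<ominus>\<^bsub>R\<^esub> u \<in> A" using A_smult u by simp
      have "s (\<ominus>\<^bsub>R\<^esub> u) \<oplus>\<^bsub>R'\<^esub> x = \<zero>\<^bsub>R'\<^esub>"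
        using u m A_in by (simp add: R'_def R.l_neg)
      then show "\<exists>y\<in>carrier R'. y \<oplus>\<^bsub>R'\<^esub> x = \<zero>\<^bsub>R'\<^esub>"
        using m by (auto simp: R'_def)
    qed (auto simp: R'_def A_add A_zero A_in R.a_ac)
    show "monoid R'"
      by (rule monoidI) (auto simp: R'_def A_mult A_one A_in R.m_assoc)
  qed (auto simp: R'_def A_add A_mult A_in R.l_distr R.r_distr)
  have "module K R'"
    by (rule moduleI)
      (auto simp: R'_def A_smult A_add A_in R.smult_l_distr R.smult_r_distr R.smult_assoc1
        intro: R.R.cring_axioms ring.is_abelian_group[OF ring, unfolded R'_def])
  then have alg: "unital_assoc_algebra K R'"
    by (intro unital_assoc_algebra.intro unital_assoc_algebra_axioms.intro ring)
      (auto simp: R'_def A_smult A_mult A_in A_one A_zero s_inj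
        R.smult_mult_left R.smult_mult_right R.one_neq_zero)
  have "partial_proj_rep K G R' (s \<circ> \<Gamma>) \<sigma>"
    using rep unfolding partial_proj_rep_def
    by (auto simp: R'_def s_inj A_\<Gamma> A_mult A_zero A_smult \<sigma>)
  with alg ext \<sigma> show ?thesis
    by (auto simp: pm_def PiE_def)
qed


section \<open>The infinite dihedral group\<close>

text \<open>The pair \<open>(e, i)\<close> stands for \<open>b\<^sup>e a\<^sup>i\<close>.\<close>

definition D_inf :: "(bool \<times> int) monoid" where
  "D_inf = \<lparr>carrier = UNIV,
     mult = (\<lambda>(e, i) (f, j). (e \<noteq> f, (if f then - i else i) + j)),
     one = (False, 0)\<rparr>"

definition da :: "bool \<times> int" where "da = (False, 1)"

definition db :: "bool \<times> int" where "db = (True, 0)"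

lemma carrier_D_inf [simp]: "carrier D_inf = UNIV"
  by (simp add: D_inf_def)

lemma mult_D_inf [simp]:
  "(e, i) \<otimes>\<^bsub>D_inf\<^esub> (f, j) = (e \<noteq> f, (if f then - i else i) + j)"
  by (simp add: D_inf_def)

lemma one_D_inf [simp]: "\<one>\<^bsub>D_inf\<^esub> = (False, 0)"
  by (simp add: D_inf_def)

lemma group_D_inf: "group D_inf"
proof (rule groupI)
  fix x assume "x \<in> carrier D_inf"
  show "\<exists>y\<in>carrier D_inf. y \<otimes>\<^bsub>D_inf\<^esub> x = \<one>\<^bsub>D_inf\<^esub>"
    by (cases x) (rule bexI[of _ "(fst x, if fst x then snd x else - snd x)"], auto)
qed auto

interpretation D: group D_inf
  by (rule group_D_inf)

lemma inv_D_inf [simp]: "inv\<^bsub>D_inf\<^esub> (e, i) = (e, if e then i else - i)"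
  by (rule D.inv_equality) auto

lemma da_pow: "da [^]\<^bsub>D_inf\<^esub> (i :: int) = (False, i)"
proof -
  have nat: "da [^]\<^bsub>D_inf\<^esub> (n :: nat) = (False, int n)" for n
    by (induction n) (auto simp: da_def)
  show ?thesis
    by (cases i rule: int_cases2) (simp_all add: int_pow_int D.int_pow_neg nat)
qed

lemma db_da_pow: "db \<otimes>\<^bsub>D_inf\<^esub> da [^]\<^bsub>D_inf\<^esub> (i :: int) = (True, i)"
  by (simp add: da_pow db_def)

lemma D_inf_normal_form:
  "(e, i) = (if e then db else \<one>\<^bsub>D_inf\<^esub>) \<otimes>\<^bsub>D_inf\<^esub> da [^]\<^bsub>D_inf\<^esub> i"
  by (simp add: da_pow db_def)

text \<open>\<^const>\<open>D_inf\<close> has the presentation \<open>\<langle>a, b | b\<^sup>2 = 1, ba = a\<^sup>-\<^sup>1b\<rangle>\<close>: the relations hold, and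
  any two elements of a group that satisfy them are the images of \<open>a, b\<close> under a unique
  homomorphism.\<close>

lemma D_inf_relations:
  "db \<otimes>\<^bsub>D_inf\<^esub> db = \<one>\<^bsub>D_inf\<^esub>"
  "db \<otimes>\<^bsub>D_inf\<^esub> da = inv\<^bsub>D_inf\<^esub> da \<otimes>\<^bsub>D_inf\<^esub> db"
  by (simp_all add: da_def db_def)

lemma D_inf_universal:
  fixes H :: "('h, 'n) monoid_scheme" (structure)
  assumes H: "group H" and xy: "x \<in> carrier H" "y \<in> carrier H"
    and rel: "y \<otimes> y = \<one>" "y \<otimes> x = inv x \<otimes> y"
  shows "\<exists>!f. f \<in> hom D_inf H \<and> f da = x \<and> f db = y"
proof -
  interpret H: group H by (rule H)
  note [simp] = xy
  have inv_y: "inv y = y" using rel(1) by (intro H.inv_equality) auto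
  have conj: "x = y \<otimes> inv x \<otimes> y"
  proof -
    have "y \<otimes> inv x \<otimes> y = y \<otimes> (y \<otimes> x)" by (simp add: rel(2) H.m_assoc)
    also have "\<dots> = x" by (simp add: rel(1) flip: H.m_assoc)
    finally show ?thesis by simp
  qed
  have nat: "x [^] n \<otimes> y = y \<otimes> inv x [^] n" for n :: nat
  proof (induction n)
    case (Suc n)
    have xy': "x \<otimes> y = y \<otimes> inv x"
    proof -
      have "x \<otimes> y = y \<otimes> inv x \<otimes> y \<otimes> y" by (subst conj) simp
      then show ?thesis by (simp add: H.m_assoc rel(1))
    qed
    have "x [^] Suc n \<otimes> y = x [^] n \<otimes> (x \<otimes> y)" by (simp add: H.m_assoc)
    also have "\<dots> = (x [^] n \<otimes> y) \<otimes> inv x" by (simp add: xy' H.m_assoc)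
    also have "\<dots> = y \<otimes> inv x [^] Suc n" by (simp add: Suc H.m_assoc)
    finally show ?case .
  qed simp
  have comm: "x [^] i \<otimes> y = y \<otimes> x [^] (- i)" for i :: int
  proof (cases i rule: int_cases2)
    case (nonneg n)
    then show ?thesis
      using nat[of n] by (simp add: int_pow_int H.int_pow_neg H.nat_pow_inv)
  next
    case (nonpos n)
    have "y \<otimes> x [^] n = y \<otimes> (x [^] n \<otimes> y) \<otimes> y" by (simp add: H.m_assoc rel(1))
    also have "\<dots> = inv x [^] n \<otimes> y" by (simp add: nat rel(1) flip: H.m_assoc)
    finally show ?thesis
      using nonpos by (simp add: int_pow_int H.int_pow_neg H.nat_pow_inv)
  qed
  define f where "f = (\<lambda>(e, i :: int). (if e then y else \<one>) \<otimes> x [^] i)"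
  have "f \<in> hom D_inf H"
  proof (rule homI)
    fix p q :: "bool \<times> int"
    obtain e i e' j where pq: "p = (e, i)" "q = (e', j)" by fastforce
    have a: "x [^] i \<otimes> (y \<otimes> x [^] j) = y \<otimes> x [^] (j - i)"
    proof -
      have "x [^] i \<otimes> (y \<otimes> x [^] j) = (x [^] i \<otimes> y) \<otimes> x [^] j" by (simp add: H.m_assoc)
      also have "\<dots> = y \<otimes> (x [^] (- i) \<otimes> x [^] j)" by (simp add: comm H.m_assoc)
      also have "x [^] (- i) \<otimes> x [^] j = x [^] (j - i)" by (simp flip: H.int_pow_mult)
      finally show ?thesis .
    qed
    have b: "y \<otimes> (y \<otimes> z) = z" if "z \<in> carrier H" for z
      using that by (simp add: rel(1) flip: H.m_assoc)
    show "f (p \<otimes>\<^bsub>D_inf\<^esub> q) = f p \<otimes> f q"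
      by (cases e; cases e') (simp_all add: pq f_def H.m_assoc a b H.int_pow_mult)
  qed (auto simp: f_def)
  moreover have "f da = x" "f db = y" by (simp_all add: f_def da_def db_def)
  moreover have "g = f" if g: "g \<in> hom D_inf H" "g da = x" "g db = y" for g
  proof
    fix p :: "bool \<times> int"
    obtain e i where p: "p = (e, i)" by fastforce
    interpret gh: group_hom D_inf H g
      using g(1) by (simp add: group_hom_def group_hom_axioms_def group_D_inf H)
    have "g (False, i) = x [^] i"
      using gh.hom_int_pow[of da i] by (simp add: da_pow g)
    moreover have "(True, i) = db \<otimes>\<^bsub>D_inf\<^esub> (False, i)" by (simp add: db_def)
    then have "g (True, i) = y \<otimes> g (False, i)"
      using gh.hom_mult[of db "(False, i)"] g by simp
    ultimately show "g p = f p" by (cases e) (simp_all add: p f_def)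
  qed
  ultimately show ?thesis by blast
qed


section \<open>The factor sets attached to two families of parameters\<close>

text \<open>\<open>\<int>\<^sup>+\<close> is \<open>{1..}\<close> as a set of integers, and families on it are extensional functions.\<close>

definition nu_index :: "(int + int) set" where
  "nu_index = {1..} <+> UNIV"

definition omega_index :: "(int \<times> int + int \<times> int) set" where
  "omega_index = ({1..} \<times> {1..}) <+> ({1..} \<times> UNIV)"

definition zero_one :: "nat monoid" where
  "zero_one = \<lparr>carrier = {0, 1}, mult = (*), one = 1\<rparr>"

definition nu_semigroup :: "(int + int \<Rightarrow> nat) monoid" where
  "nu_semigroup = product_group nu_index (\<lambda>_. zero_one)"

definition omega_semigroup ::
  "('k, 'm) ring_scheme \<Rightarrow> (int \<times> int + int \<times> int \<Rightarrow> 'k) monoid" where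
  "omega_semigroup K = product_group omega_index (\<lambda>_. K)"

definition S_nu :: "(int + int \<Rightarrow> nat) \<Rightarrow> (bool \<times> int) set" where
  "S_nu \<nu> =
     (\<Union>i\<in>{i \<in> {1..}. \<nu> (Inl i) = 0}. {da [^]\<^bsub>D_inf\<^esub> i, da [^]\<^bsub>D_inf\<^esub> (- i)}) \<union>
     {db \<otimes>\<^bsub>D_inf\<^esub> da [^]\<^bsub>D_inf\<^esub> i |i. \<nu> (Inr i) = 0}"

definition sigma_nu ::
  "('k, 'm) ring_scheme \<Rightarrow> (int + int \<Rightarrow> nat) \<Rightarrow> (bool \<times> int) \<times> (bool \<times> int) \<Rightarrow> 'k" where
  "sigma_nu K \<nu> = (\<lambda>(x, y).
     if {x, y, x \<otimes>\<^bsub>D_inf\<^esub> y} \<inter> S_nu \<nu> \<noteq> {} then \<zero>\<^bsub>K\<^esub> else \<one>\<^bsub>K\<^esub>)"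

fun rep_pair :: "int \<times> int + int \<times> int \<Rightarrow> (bool \<times> int) \<times> (bool \<times> int)" where
  "rep_pair (Inl (n, m)) = (da [^]\<^bsub>D_inf\<^esub> n, da [^]\<^bsub>D_inf\<^esub> m)"
| "rep_pair (Inr (i, j)) = (da [^]\<^bsub>D_inf\<^esub> i, db \<otimes>\<^bsub>D_inf\<^esub> da [^]\<^bsub>D_inf\<^esub> j)"

text \<open>The two halves of the set \<open>C\<^bsub>(x,y)\<^esub>\<close>.\<close>

definition C_pos :: "(bool \<times> int) \<times> (bool \<times> int) \<Rightarrow> ((bool \<times> int) \<times> (bool \<times> int)) set" where
  "C_pos = (\<lambda>(x, y).
     {(x, y),
      (y, inv\<^bsub>D_inf\<^esub> y \<otimes>\<^bsub>D_inf\<^esub> inv\<^bsub>D_inf\<^esub> x),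
      (inv\<^bsub>D_inf\<^esub> y \<otimes>\<^bsub>D_inf\<^esub> inv\<^bsub>D_inf\<^esub> x, x)})"

definition C_neg :: "(bool \<times> int) \<times> (bool \<times> int) \<Rightarrow> ((bool \<times> int) \<times> (bool \<times> int)) set" where
  "C_neg = (\<lambda>(x, y).
     {(inv\<^bsub>D_inf\<^esub> y, inv\<^bsub>D_inf\<^esub> x),
      (inv\<^bsub>D_inf\<^esub> x, x \<otimes>\<^bsub>D_inf\<^esub> y),
      (x \<otimes>\<^bsub>D_inf\<^esub> y, inv\<^bsub>D_inf\<^esub> y)})"

text \<open>Every other pair lies in exactly one of the sets \<open>C_pos (rep_pair r)\<close> and
  \<open>C_neg (rep_pair r)\<close>, so the definite descriptions denote: see \<open>pair_cases\<close>,
  \<open>sigma_omega_pos\<close>, \<open>sigma_omega_neg\<close> and \<open>card_C\<close>.\<close>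

definition sigma_omega ::
  "('k, 'm) ring_scheme \<Rightarrow> (int \<times> int + int \<times> int \<Rightarrow> 'k)
    \<Rightarrow> (bool \<times> int) \<times> (bool \<times> int) \<Rightarrow> 'k" where
  "sigma_omega K \<omega> = (\<lambda>(x, y).
     if x = \<one>\<^bsub>D_inf\<^esub> \<or> y = \<one>\<^bsub>D_inf\<^esub> \<or> x \<otimes>\<^bsub>D_inf\<^esub> y = \<one>\<^bsub>D_inf\<^esub> then \<one>\<^bsub>K\<^esub>
     else if \<exists>r\<in>omega_index. (x, y) \<in> C_pos (rep_pair r)
     then \<omega> (THE r. r \<in> omega_index \<and> (x, y) \<in> C_pos (rep_pair r))
     else let c = \<omega> (THE r. r \<in> omega_index \<and> (x, y) \<in> C_neg (rep_pair r))
          in if c = \<zero>\<^bsub>K\<^esub> then \<zero>\<^bsub>K\<^esub> else inv\<^bsub>K\<^esub> c)"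

declare rep_pair.simps [simp del]

lemma mem_omega_index:
  "r \<in> omega_index \<longleftrightarrow>
    (\<exists>n m. r = Inl (n, m) \<and> n \<ge> 1 \<and> m \<ge> 1) \<or> (\<exists>i j. r = Inr (i, j) \<and> i \<ge> 1)"
  by (auto simp: omega_index_def)

lemma mem_C_pos_Inl:
  "((e, u), (f, v)) \<in> C_pos (rep_pair (Inl (n, m))) \<longleftrightarrow>
    \<not> e \<and> \<not> f \<and> (u = n \<and> v = m \<or> u = m \<and> v = - n - m \<or> u = - n - m \<and> v = n)"
  by (auto simp: rep_pair.simps C_pos_def da_pow)

lemma mem_C_neg_Inl:
  "((e, u), (f, v)) \<in> C_neg (rep_pair (Inl (n, m))) \<longleftrightarrow>
    \<not> e \<and> \<not> f \<and> (u = - m \<and> v = - n \<or> u = - n \<and> v = n + m \<or> u = n + m \<and> v = - m)"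
  by (auto simp: rep_pair.simps C_neg_def da_pow)

lemma mem_C_pos_Inr:
  "((e, u), (f, v)) \<in> C_pos (rep_pair (Inr (i, j))) \<longleftrightarrow>
    \<not> e \<and> f \<and> u = i \<and> v = j \<or> e \<and> f \<and> u = j \<and> v = j - i \<or> e \<and> \<not> f \<and> u = j - i \<and> v = i"
  by (auto simp: rep_pair.simps C_pos_def da_pow db_def)

lemma mem_C_neg_Inr:
  "((e, u), (f, v)) \<in> C_neg (rep_pair (Inr (i, j))) \<longleftrightarrow>
    e \<and> \<not> f \<and> u = j \<and> v = - i \<or> \<not> e \<and> f \<and> u = - i \<and> v = j - i \<or> e \<and> f \<and> u = j - i \<and> v = j"
  by (auto simp: rep_pair.simps C_neg_def da_pow db_def)

lemmas mem_C = mem_C_pos_Inl mem_C_neg_Inl mem_C_pos_Inr mem_C_neg_Inr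

lemma C_nontrivial:
  assumes "r \<in> omega_index" "(x, y) \<in> C_pos (rep_pair r) \<union> C_neg (rep_pair r)"
  shows "x \<noteq> \<one>\<^bsub>D_inf\<^esub> \<and> y \<noteq> \<one>\<^bsub>D_inf\<^esub> \<and> x \<otimes>\<^bsub>D_inf\<^esub> y \<noteq> \<one>\<^bsub>D_inf\<^esub>"
  using assms by (cases x; cases y) (auto simp: mem_omega_index mem_C)

lemma C_pos_unique:
  assumes r: "r \<in> omega_index" "r' \<in> omega_index"
    and p: "p \<in> C_pos (rep_pair r)" "p \<in> C_pos (rep_pair r')"
  shows "r = r'"
proof -
  obtain e u f v where puv: "p = ((e, u), (f, v))" by (metis surj_pair)
  consider (LL) n m n' m' where "r = Inl (n, m)" "r' = Inl (n', m')" "n \<ge> 1" "m \<ge> 1" "n' \<ge> 1" "m' \<ge> 1"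
    | (LR) n m i j where "r = Inl (n, m)" "r' = Inr (i, j)"
    | (RL) n m i j where "r = Inr (i, j)" "r' = Inl (n, m)"
    | (RR) i j i' j' where "r = Inr (i, j)" "r' = Inr (i', j')" "i \<ge> 1" "i' \<ge> 1"
    using r unfolding mem_omega_index by blast
  then show ?thesis
  proof cases
    case LL
    have "n = n' \<and> m = m'"
      using p LL(3-6) unfolding puv LL(1,2) mem_C by (intro conjI; elim conjE disjE; linarith)
    then show ?thesis using LL by simp
  next
    case LR then show ?thesis using p unfolding puv LR mem_C by blast
  next
    case RL then show ?thesis using p unfolding puv RL mem_C by blast
  next
    case RR
    have "i = i' \<and> j = j'"
      using p RR(3,4) unfolding puv RR(1,2) mem_C
      by (intro conjI; elim conjE disjE; (erule (1) notE | linarith))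
    then show ?thesis using RR by simp
  qed
qed

lemma C_neg_unique:
  assumes r: "r \<in> omega_index" "r' \<in> omega_index"
    and p: "p \<in> C_neg (rep_pair r)" "p \<in> C_neg (rep_pair r')"
  shows "r = r'"
proof -
  obtain e u f v where puv: "p = ((e, u), (f, v))" by (metis surj_pair)
  consider (LL) n m n' m' where "r = Inl (n, m)" "r' = Inl (n', m')" "n \<ge> 1" "m \<ge> 1" "n' \<ge> 1" "m' \<ge> 1"
    | (LR) n m i j where "r = Inl (n, m)" "r' = Inr (i, j)"
    | (RL) n m i j where "r = Inr (i, j)" "r' = Inl (n, m)"
    | (RR) i j i' j' where "r = Inr (i, j)" "r' = Inr (i', j')" "i \<ge> 1" "i' \<ge> 1"
    using r unfolding mem_omega_index by blast
  then show ?thesis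
  proof cases
    case LL
    have "n = n' \<and> m = m'"
      using p LL(3-6) unfolding puv LL(1,2) mem_C by (intro conjI; elim conjE disjE; linarith)
    then show ?thesis using LL by simp
  next
    case LR then show ?thesis using p unfolding puv LR mem_C by blast
  next
    case RL then show ?thesis using p unfolding puv RL mem_C by blast
  next
    case RR
    have "i = i' \<and> j = j'"
      using p RR(3,4) unfolding puv RR(1,2) mem_C
      by (intro conjI; elim conjE disjE; (erule (1) notE | linarith))
    then show ?thesis using RR by simp
  qed
qed

lemma C_pos_neg_disjoint:
  assumes r: "r \<in> omega_index" "r' \<in> omega_index"
    and p: "p \<in> C_pos (rep_pair r)" "p \<in> C_neg (rep_pair r')"
  shows "False"
proof -
  obtain e u f v where puv: "p = ((e, u), (f, v))" by (metis surj_pair)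
  consider (LL) n m n' m' where "r = Inl (n, m)" "r' = Inl (n', m')" "n \<ge> 1" "m \<ge> 1" "n' \<ge> 1" "m' \<ge> 1"
    | (LR) n m i j where "r = Inl (n, m)" "r' = Inr (i, j)"
    | (RL) n m i j where "r = Inr (i, j)" "r' = Inl (n, m)"
    | (RR) i j i' j' where "r = Inr (i, j)" "r' = Inr (i', j')" "i \<ge> 1" "i' \<ge> 1"
    using r unfolding mem_omega_index by blast
  then show ?thesis
  proof cases
    case LL
    then show ?thesis
      using p unfolding puv LL(1,2) mem_C by (elim conjE disjE; linarith)
  next
    case LR then show ?thesis using p unfolding puv LR mem_C by blast
  next
    case RL then show ?thesis using p unfolding puv RL mem_C by blast
  next
    case RR
    then show ?thesis
      using p unfolding puv RR(1,2) mem_C by (elim conjE disjE; (erule (1) notE | linarith))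
  qed
qed

lemma pair_cases:
  obtains (trivial) "x = \<one>\<^bsub>D_inf\<^esub> \<or> y = \<one>\<^bsub>D_inf\<^esub> \<or> x \<otimes>\<^bsub>D_inf\<^esub> y = \<one>\<^bsub>D_inf\<^esub>"
  | (pos) r where "r \<in> omega_index" "(x, y) \<in> C_pos (rep_pair r)"
  | (neg) r where "r \<in> omega_index" "(x, y) \<in> C_neg (rep_pair r)"
proof -
  obtain e u f v where xy: "x = (e, u)" "y = (f, v)" by fastforce
  have "\<exists>r\<in>omega_index. (x, y) \<in> C_pos (rep_pair r) \<union> C_neg (rep_pair r)"
    if nt: "\<not> (x = \<one>\<^bsub>D_inf\<^esub> \<or> y = \<one>\<^bsub>D_inf\<^esub> \<or> x \<otimes>\<^bsub>D_inf\<^esub> y = \<one>\<^bsub>D_inf\<^esub>)"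
  proof -
    have Inl: ?thesis if "((e, u), (f, v)) \<in> C_pos (rep_pair (Inl (n, m))) \<or>
        ((e, u), (f, v)) \<in> C_neg (rep_pair (Inl (n, m)))" "n \<ge> 1" "m \<ge> 1" for n m
      using that xy by (intro bexI[of _ "Inl (n, m)"]) (auto simp: mem_omega_index)
    have Inr: ?thesis if "((e, u), (f, v)) \<in> C_pos (rep_pair (Inr (i, j))) \<or>
        ((e, u), (f, v)) \<in> C_neg (rep_pair (Inr (i, j)))" "i \<ge> 1" for i j
      using that xy by (intro bexI[of _ "Inr (i, j)"]) (auto simp: mem_omega_index)
    consider (rr) "e" "f" "u \<noteq> v" | (rt) "e" "\<not> f" "v \<noteq> 0" | (tr) "\<not> e" "f" "u \<noteq> 0"
      | (tt) "\<not> e" "\<not> f" "u \<noteq> 0" "v \<noteq> 0" "u + v \<noteq> 0"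
      using nt xy by (cases e; cases f) simp_all
    then consider "e" "f" "u > v" | "e" "f" "u < v" | "e" "\<not> f" "v > 0" | "e" "\<not> f" "v < 0"
      | "\<not> e" "f" "u > 0" | "\<not> e" "f" "u < 0"
      | "\<not> e" "\<not> f" "u > 0" "v > 0" | "\<not> e" "\<not> f" "u < 0" "v < 0"
      | "\<not> e" "\<not> f" "u > 0" "v < 0" "u + v > 0" | "\<not> e" "\<not> f" "u > 0" "v < 0" "u + v < 0"
      | "\<not> e" "\<not> f" "u < 0" "v > 0" "u + v > 0" | "\<not> e" "\<not> f" "u < 0" "v > 0" "u + v < 0"
      by cases (meson linorder_neqE)+
    then show ?thesis
    proof cases
      case 1 then show ?thesis by (intro Inr[of "u - v" u]) (auto simp: mem_C)
    next
      case 2 then show ?thesis by (intro Inr[of "v - u" v]) (auto simp: mem_C)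
    next
      case 3 then show ?thesis by (intro Inr[of v "u + v"]) (auto simp: mem_C)
    next
      case 4 then show ?thesis by (intro Inr[of "- v" u]) (auto simp: mem_C)
    next
      case 5 then show ?thesis by (intro Inr[of u v]) (auto simp: mem_C)
    next
      case 6 then show ?thesis by (intro Inr[of "- u" "v - u"]) (auto simp: mem_C)
    next
      case 7 then show ?thesis by (intro Inl[of u v]) (auto simp: mem_C)
    next
      case 8 then show ?thesis by (intro Inl[of "- v" "- u"]) (auto simp: mem_C)
    next
      case 9 then show ?thesis by (intro Inl[of "u + v" "- v"]) (auto simp: mem_C)
    next
      case 10 then show ?thesis by (intro Inl[of "- u - v" u]) (auto simp: mem_C)
    next
      case 11 then show ?thesis by (intro Inl[of "- u" "u + v"]) (auto simp: mem_C)
    next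
      case 12 then show ?thesis by (intro Inl[of v "- u - v"]) (auto simp: mem_C)
    qed
  qed
  then show ?thesis using that by blast
qed

lemma card_C: "r \<in> omega_index \<Longrightarrow> card (C_pos (rep_pair r) \<union> C_neg (rep_pair r)) = 6"
  by (auto simp: mem_omega_index rep_pair.simps C_pos_def C_neg_def da_pow db_def)

lemma sigma_omega_trivial:
  "x = \<one>\<^bsub>D_inf\<^esub> \<or> y = \<one>\<^bsub>D_inf\<^esub> \<or> x \<otimes>\<^bsub>D_inf\<^esub> y = \<one>\<^bsub>D_inf\<^esub> \<Longrightarrow>
    sigma_omega K \<omega> (x, y) = \<one>\<^bsub>K\<^esub>"
  unfolding sigma_omega_def by (simp only: prod.case if_True)

lemma sigma_omega_pos:
  assumes r: "r \<in> omega_index" "p \<in> C_pos (rep_pair r)"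
  shows "sigma_omega K \<omega> p = \<omega> r"
proof -
  obtain x y where p: "p = (x, y)" by (cases p)
  have the: "(THE r. r \<in> omega_index \<and> (x, y) \<in> C_pos (rep_pair r)) = r"
    using C_pos_unique r p by blast
  show ?thesis
    unfolding sigma_omega_def p prod.case the
    using C_nontrivial[of r x y] r p by auto
qed

lemma sigma_omega_neg:
  assumes r: "r \<in> omega_index" "p \<in> C_neg (rep_pair r)"
  shows "sigma_omega K \<omega> p = (if \<omega> r = \<zero>\<^bsub>K\<^esub> then \<zero>\<^bsub>K\<^esub> else inv\<^bsub>K\<^esub> (\<omega> r))"
proof -
  obtain x y where p: "p = (x, y)" by (cases p)
  have the: "(THE r. r \<in> omega_index \<and> (x, y) \<in> C_neg (rep_pair r)) = r"
    using C_neg_unique r p by blast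
  have "\<not> (\<exists>r\<in>omega_index. (x, y) \<in> C_pos (rep_pair r))"
    using C_pos_neg_disjoint r p by blast
  then show ?thesis
    unfolding sigma_omega_def p prod.case the Let_def
    using C_nontrivial[of r x y] r p by auto
qed

definition decomposes ::
  "('k, 'm) ring_scheme \<Rightarrow> ((bool \<times> int) \<times> (bool \<times> int) \<Rightarrow> 'k)
    \<Rightarrow> (int + int \<Rightarrow> nat) \<Rightarrow> (int \<times> int + int \<times> int \<Rightarrow> 'k) \<Rightarrow> bool" where
  "decomposes K \<sigma> \<nu> \<omega> \<longleftrightarrow>
     \<sigma> = sigma_nu K \<nu> \<otimes>\<^bsub>maps_monoid K D_inf\<^esub> sigma_omega K \<omega> \<and>
     Null K D_inf (sigma_nu K \<nu>) \<inter> Null K D_inf (sigma_omega K \<omega>) = {}"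


section \<open>How unique the decomposition is\<close>

text \<open>
  On \<open>Null(\<sigma>\<^sub>\<nu>)\<close> the product \<open>\<sigma>\<^sub>\<nu>\<sigma>\<^sub>\<omega>\<close> vanishes, and \<^const>\<open>decomposes\<close> constrains \<open>\<sigma>\<^sub>\<omega>\<close> there only to
  be nonzero. So \<open>\<omega>\<close> can be determined only at the representatives outside \<open>Null(\<sigma>\<^sub>\<nu>)\<close>. Over
  any field with more than two elements, full uniqueness of \<open>\<omega>\<close> fails: the factor set of the
  representation with \<open>\<Gamma>(1) = 1\<close> and \<open>\<Gamma>(g) = 0\<close> for \<open>g \<noteq> 1\<close> is \<open>\<sigma>\<^sub>\<nu>\<close> with \<open>\<nu> = 0\<close>, and it
  equals \<open>\<sigma>\<^sub>\<nu>\<sigma>\<^sub>\<omega>\<close> for every \<open>\<omega>\<close> without zeros.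
\<close>

lemma S_nu_zero: "S_nu (\<lambda>r\<in>nu_index. 0) = UNIV - {\<one>\<^bsub>D_inf\<^esub>}"
proof -
  have "(False, i) \<in> S_nu (\<lambda>r\<in>nu_index. 0)" if "i \<noteq> 0" for i
    unfolding S_nu_def
    by (rule UnI1, rule UN_I[of "\<bar>i\<bar>"]) (use that in \<open>auto simp: nu_index_def da_pow\<close>)
  moreover have "(True, i) \<in> S_nu (\<lambda>r\<in>nu_index. 0)" for i
    by (auto simp: S_nu_def nu_index_def db_da_pow)
  moreover have "(False, 0) \<notin> S_nu (\<lambda>r\<in>nu_index. 0)"
    by (auto simp: S_nu_def da_pow db_def)
  ultimately show ?thesis by (auto, metis (full_types))
qed

lemma sigma_nu_zero:
  "sigma_nu K (\<lambda>r\<in>nu_index. 0) (x, y) = (if x = \<one>\<^bsub>D_inf\<^esub> \<and> y = \<one>\<^bsub>D_inf\<^esub> then \<one>\<^bsub>K\<^esub> else \<zero>\<^bsub>K\<^esub>)"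
  unfolding sigma_nu_def S_nu_zero by auto

lemma sigma_nu_zero_in_pm':
  assumes "field K"
  shows "sigma_nu K (\<lambda>r\<in>nu_index. 0) \<in> pm' K D_inf"
proof -
  interpret K: field K by (rule assms)
  define R :: "('a, 'a) module" where
    "R = \<lparr>carrier = carrier K, mult = mult K, one = \<one>\<^bsub>K\<^esub>, zero = \<zero>\<^bsub>K\<^esub>, add = add K, smult = mult K\<rparr>"
  define \<Gamma> where "\<Gamma> = (\<lambda>g. if g = \<one>\<^bsub>D_inf\<^esub> then \<one>\<^bsub>K\<^esub> else \<zero>\<^bsub>K\<^esub>)"
  have ab: "abelian_group R"
    by (rule abelian_groupI)
      (auto simp: R_def K.a_ac intro!: bexI[of _ "\<ominus>\<^bsub>K\<^esub> _"] K.l_neg)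
  have "ring R"
    by (rule ringI[OF ab], rule monoidI) (auto simp: R_def K.m_assoc K.l_distr K.r_distr)
  moreover have "module K R"
    by (rule moduleI[OF K.cring_axioms ab]) (auto simp: R_def K.m_assoc K.l_distr K.r_distr)
  ultimately have "unital_assoc_algebra K R"
    by (intro unital_assoc_algebra.intro unital_assoc_algebra_axioms.intro)
      (auto simp: R_def K.m_assoc K.m_lcomm)
  moreover have "partial_proj_rep K D_inf R \<Gamma> (sigma_nu K (\<lambda>r\<in>nu_index. 0))"
    unfolding partial_proj_rep_def R_def \<Gamma>_def by (auto simp: sigma_nu_zero split: if_splits)
  ultimately have "sigma_nu K (\<lambda>r\<in>nu_index. 0) \<in> pm K D_inf"
    by (intro factor_set_in_pm[OF group_D_inf]) auto
  then show ?thesis by (auto simp: pm'_def sigma_nu_zero)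
qed

lemma omega_not_unique:
  assumes "field K" and c: "c \<in> carrier K" "c \<noteq> \<zero>\<^bsub>K\<^esub>" "c \<noteq> \<one>\<^bsub>K\<^esub>"
  shows "\<exists>\<sigma>\<in>pm' K D_inf. \<exists>\<nu>\<in>carrier nu_semigroup. \<exists>\<omega>\<in>carrier (omega_semigroup K).
           \<exists>\<omega>'\<in>carrier (omega_semigroup K).
             decomposes K \<sigma> \<nu> \<omega> \<and> decomposes K \<sigma> \<nu> \<omega>' \<and> \<omega> \<noteq> \<omega>'"
proof -
  interpret K: field K by (rule assms)
  let ?\<nu> = "\<lambda>r\<in>nu_index. 0 :: nat"
  have dec: "decomposes K (sigma_nu K ?\<nu>) ?\<nu> (\<lambda>r\<in>omega_index. d)"
    if d: "d \<in> carrier K" "d \<noteq> \<zero>\<^bsub>K\<^esub>" for d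
  proof -
    have inv: "inv\<^bsub>K\<^esub> d \<in> carrier K" "inv\<^bsub>K\<^esub> d \<noteq> \<zero>\<^bsub>K\<^esub>"
      using d K.field_Units by (auto dest: K.Units_inv_Units)
    have nz: "sigma_omega K (\<lambda>r\<in>omega_index. d) (x, y) \<in> carrier K - {\<zero>\<^bsub>K\<^esub>}" for x y
      by (cases x y rule: pair_cases)
        (simp_all add: sigma_omega_trivial[simplified] sigma_omega_pos sigma_omega_neg d inv)
    have one: "sigma_omega K (\<lambda>r\<in>omega_index. d) (\<one>\<^bsub>D_inf\<^esub>, \<one>\<^bsub>D_inf\<^esub>) = \<one>\<^bsub>K\<^esub>"
      by (rule sigma_omega_trivial) blast
    have "sigma_nu K ?\<nu> p = sigma_nu K ?\<nu> p \<otimes>\<^bsub>K\<^esub> sigma_omega K (\<lambda>r\<in>omega_index. d) p" for p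
      using nz one by (cases p) (auto simp: sigma_nu_zero)
    then have "sigma_nu K ?\<nu> = sigma_nu K ?\<nu> \<otimes>\<^bsub>maps_monoid K D_inf\<^esub> sigma_omega K (\<lambda>r\<in>omega_index. d)"
      by (auto simp: maps_monoid_def product_group_def)
    then show ?thesis using nz by (auto simp: decomposes_def Null_def)
  qed
  have "Inl (1, 1) \<in> omega_index" by (simp add: mem_omega_index)
  then have "(\<lambda>r\<in>omega_index. \<one>\<^bsub>K\<^esub>) \<noteq> (\<lambda>r\<in>omega_index. c)"
    using c(3) by (metis restrict_apply')
  moreover have "?\<nu> \<in> carrier nu_semigroup"
    by (simp add: nu_semigroup_def zero_one_def)
  moreover have "(\<lambda>r\<in>omega_index. d) \<in> carrier (omega_semigroup K)" if "d \<in> carrier K" for d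
    using that by (simp add: omega_semigroup_def)
  ultimately show ?thesis
    using dec[of "\<one>\<^bsub>K\<^esub>"] dec[OF c(1,2)] sigma_nu_zero_in_pm'[OF assms(1)] c(1)
    by (metis K.one_closed K.zero_not_one)
qed

end

theory Submission
  imports Defs
begin

text \<open>
  If \<open>\<Gamma>\<close> has factor set \<open>\<sigma>\<close> with \<open>\<sigma>(g, g\<^sup>-\<^sup>1) \<in> {0, 1}\<close>, then \<open>\<Gamma>(g)\<Gamma>(g\<^sup>-\<^sup>1)\<Gamma>(g) = \<Gamma>(g)\<close>, and
  multiplying (iv) by \<open>\<Gamma>(g)\<close> and (v) by \<open>\<Gamma>(h)\<close> shows that, wherever \<open>\<sigma>(g, h) \<noteq> 0\<close>, the involutions
  \<open>(g, h) \<mapsto> (g\<^sup>-\<^sup>1, gh)\<close> and \<open>(g, h) \<mapsto> (gh, h\<^sup>-\<^sup>1)\<close> invert \<open>\<sigma>\<close>. They generate an action of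
  \<open>S\<^sub>3\<close> with orbits \<open>C\<^bsub>(x,y)\<^esub>\<close>. No cocycle identity relates different orbits: given a
  \<open>\<sigma>\<close> with this symmetry and a pair with \<open>\<sigma>(g, h) \<noteq> 0\<close>, let \<open>\<Gamma>(x)\<close> act on the space with basis
  \<open>T = {gh, h, 1}\<close> as the translation \<open>t \<mapsto> xt\<close> (or zero if \<open>xt \<notin> T\<close>) with weight \<open>\<sigma>(x, t)\<close>; the only
  identities needed on three points are instances of the \<open>S\<^sub>3\<close>-symmetry. The direct sum of these actions
  over all pairs \<open>(g, h)\<close> has factor set \<open>\<sigma>\<close>. So \<open>pm'\<close> is the set of all normalized \<open>\<sigma>\<close>
  with the \<open>S\<^sub>3\<close>-symmetry, which on \<open>D\<^sub>\<infinity>\<close> is freely parametrized by the support and one value per orbit.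
\<close>

section \<open>Factor sets as twists with an \<open>S\<^sub>3\<close>-symmetry\<close>

text \<open>The conditions that characterise the factor sets in question (\<open>pm'_iff\<close>).
  Both symmetry laws are required only at nonzero values, so that zeros are allowed. The value at
  \<open>(1, g)\<close> is not fixed to be one: it is zero exactly when
  \<open>\<sigma> (g, inv g)\<close> is.\<close>

locale normalized_twist = K: field K + G: group G
  for K :: "('k, 'm) ring_scheme" and G :: "('g, 'n) monoid_scheme" +
  fixes \<sigma> :: "'g \<times> 'g \<Rightarrow> 'k"
  assumes twist_closed:
      "\<lbrakk>g \<in> carrier G; h \<in> carrier G\<rbrakk> \<Longrightarrow> \<sigma> (g, h) \<in> carrier K"
    and twist_one: "\<sigma> (\<one>\<^bsub>G\<^esub>, \<one>\<^bsub>G\<^esub>) = \<one>\<^bsub>K\<^esub>"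
    and twist_inv: "g \<in> carrier G \<Longrightarrow> \<sigma> (g, inv\<^bsub>G\<^esub> g) \<in> {\<zero>\<^bsub>K\<^esub>, \<one>\<^bsub>K\<^esub>}"
    and twist_supp_left:
      "\<lbrakk>g \<in> carrier G; h \<in> carrier G; \<sigma> (g, h) \<noteq> \<zero>\<^bsub>K\<^esub>\<rbrakk> \<Longrightarrow> \<sigma> (g, inv\<^bsub>G\<^esub> g) = \<one>\<^bsub>K\<^esub>"
    and twist_supp_right:
      "\<lbrakk>g \<in> carrier G; h \<in> carrier G; \<sigma> (g, h) \<noteq> \<zero>\<^bsub>K\<^esub>\<rbrakk> \<Longrightarrow> \<sigma> (h, inv\<^bsub>G\<^esub> h) = \<one>\<^bsub>K\<^esub>"
    and twist_left:
      "\<lbrakk>g \<in> carrier G; h \<in> carrier G; \<sigma> (g, h) \<noteq> \<zero>\<^bsub>K\<^esub>\<rbrakk>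
        \<Longrightarrow> \<sigma> (g, h) \<otimes>\<^bsub>K\<^esub> \<sigma> (inv\<^bsub>G\<^esub> g, g \<otimes>\<^bsub>G\<^esub> h) = \<one>\<^bsub>K\<^esub>"
    and twist_right:
      "\<lbrakk>g \<in> carrier G; h \<in> carrier G; \<sigma> (g, h) \<noteq> \<zero>\<^bsub>K\<^esub>\<rbrakk>
        \<Longrightarrow> \<sigma> (g, h) \<otimes>\<^bsub>K\<^esub> \<sigma> (g \<otimes>\<^bsub>G\<^esub> h, inv\<^bsub>G\<^esub> h) = \<one>\<^bsub>K\<^esub>"

text \<open>If \<open>c\<close> and \<open>d\<close> differed, \<open>c - d\<close> would be a unit
  and could be divided out. This turns identities between multiples of a nonzero algebra element
  into identities of scalars.\<close>

lemma smult_cancel: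
  fixes R :: "('k, 'r, 'p) module_scheme"
  assumes "field K" "unital_assoc_algebra K R"
    and "c \<in> carrier K" "d \<in> carrier K" "x \<in> carrier R" "x \<noteq> \<zero>\<^bsub>R\<^esub>"
    and eq: "c \<odot>\<^bsub>R\<^esub> x = d \<odot>\<^bsub>R\<^esub> x"
  shows "c = d"
proof (rule ccontr)
  interpret K: field K by (rule assms)
  interpret A: unital_assoc_algebra K R by (rule assms)
  assume "c \<noteq> d"
  define e where "e = c \<ominus>\<^bsub>K\<^esub> d"
  have e: "e \<in> carrier K" "e \<noteq> \<zero>\<^bsub>K\<^esub>"
    using \<open>c \<noteq> d\<close> assms K.minus_equality[of c "\<ominus>\<^bsub>K\<^esub> d"]
    by (auto simp: e_def K.minus_eq)
  then have u: "e \<in> Units K" using K.field_Units by auto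
  have "e \<odot>\<^bsub>R\<^esub> x = \<zero>\<^bsub>R\<^esub>"
    using assms by (simp add: e_def K.minus_eq A.smult_l_distr A.smult_l_minus A.M.r_neg)
  then have "inv\<^bsub>K\<^esub> e \<odot>\<^bsub>R\<^esub> (e \<odot>\<^bsub>R\<^esub> x) = \<zero>\<^bsub>R\<^esub>"
    using u by simp
  then have "x = \<zero>\<^bsub>R\<^esub>"
    using u e assms by (simp flip: A.smult_assoc1)
  then show False using assms by simp
qed

lemma normalized_twist_of_rep:
  fixes R :: "('k, 'r, 'p) module_scheme"
  assumes K: "field K" and G: "group G" and R: "unital_assoc_algebra K R"
    and rep: "partial_proj_rep K G R \<Gamma> \<sigma>"
    and norm: "\<And>g. g \<in> carrier G \<Longrightarrow> \<sigma> (g, inv\<^bsub>G\<^esub> g) \<in> {\<zero>\<^bsub>K\<^esub>, \<one>\<^bsub>K\<^esub>}"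
  shows "normalized_twist K G \<sigma>"
proof -
  interpret K: field K by (rule K)
  interpret G: group G by (rule G)
  interpret A: unital_assoc_algebra K R by (rule R)
  have \<Gamma> [simp]: "\<Gamma> g \<in> carrier R" if "g \<in> carrier G" for g
    using rep that by (auto simp: partial_proj_rep_def)
  have \<sigma> [simp]: "\<sigma> (g, h) \<in> carrier K" if "g \<in> carrier G" "h \<in> carrier G" for g h
    using rep that by (auto simp: partial_proj_rep_def)
  have one: "\<Gamma> \<one>\<^bsub>G\<^esub> = \<one>\<^bsub>R\<^esub>" using rep by (simp add: partial_proj_rep_def)
  note conds = rep[unfolded partial_proj_rep_def, THEN conjunct2, THEN conjunct2,
      THEN conjunct1, rule_format]
  have null: "\<Gamma> g \<otimes>\<^bsub>R\<^esub> \<Gamma> h = \<zero>\<^bsub>R\<^esub> \<Longrightarrow> \<sigma> (g, h) = \<zero>\<^bsub>K\<^esub>"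
    and left: "\<Gamma> (inv\<^bsub>G\<^esub> g) \<otimes>\<^bsub>R\<^esub> \<Gamma> g \<otimes>\<^bsub>R\<^esub> \<Gamma> h
        = \<sigma> (g, h) \<odot>\<^bsub>R\<^esub> (\<Gamma> (inv\<^bsub>G\<^esub> g) \<otimes>\<^bsub>R\<^esub> \<Gamma> (g \<otimes>\<^bsub>G\<^esub> h))"
    and right: "\<Gamma> g \<otimes>\<^bsub>R\<^esub> \<Gamma> h \<otimes>\<^bsub>R\<^esub> \<Gamma> (inv\<^bsub>G\<^esub> h)
        = \<sigma> (g, h) \<odot>\<^bsub>R\<^esub> (\<Gamma> (g \<otimes>\<^bsub>G\<^esub> h) \<otimes>\<^bsub>R\<^esub> \<Gamma> (inv\<^bsub>G\<^esub> h))"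
    and nullL: "\<sigma> (g, h) = \<zero>\<^bsub>K\<^esub> \<Longrightarrow> \<Gamma> (inv\<^bsub>G\<^esub> g) \<otimes>\<^bsub>R\<^esub> \<Gamma> (g \<otimes>\<^bsub>G\<^esub> h) = \<zero>\<^bsub>R\<^esub>"
    and nullR: "\<sigma> (g, h) = \<zero>\<^bsub>K\<^esub> \<Longrightarrow> \<Gamma> (g \<otimes>\<^bsub>G\<^esub> h) \<otimes>\<^bsub>R\<^esub> \<Gamma> (inv\<^bsub>G\<^esub> h) = \<zero>\<^bsub>R\<^esub>"
    if "g \<in> carrier G" "h \<in> carrier G" for g h
    using conds[OF that] by blast+
  have supp: "\<sigma> (g, inv\<^bsub>G\<^esub> g) = \<one>\<^bsub>K\<^esub>" if "g \<in> carrier G" "\<Gamma> g \<noteq> \<zero>\<^bsub>R\<^esub>" for g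
  proof -
    \<comment> \<open>Otherwise (i) at \<open>(g, inv g)\<close> would say that the product of
      \<open>\<Gamma> 1\<close> and \<open>\<Gamma> g\<close>, which is \<open>\<Gamma> g\<close>,
      vanishes.\<close>
    have "\<sigma> (g, inv\<^bsub>G\<^esub> g) \<noteq> \<zero>\<^bsub>K\<^esub>"
      using nullR[of g "inv\<^bsub>G\<^esub> g"] that by (auto simp: one)
    then show ?thesis using norm that by blast
  qed
  \<comment> \<open>Condition (v) at \<open>(g, inv g)\<close> gives this up to the factor
    \<open>\<sigma> (g, inv g)\<close>, which is one by \<open>supp\<close>. Here the normalization
    enters.\<close>
  have von_Neumann: "\<Gamma> g \<otimes>\<^bsub>R\<^esub> \<Gamma> (inv\<^bsub>G\<^esub> g) \<otimes>\<^bsub>R\<^esub> \<Gamma> g = \<Gamma> g" if g: "g \<in> carrier G" for g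
  proof (cases "\<Gamma> g = \<zero>\<^bsub>R\<^esub>")
    case False
    then show ?thesis using right[of g "inv\<^bsub>G\<^esub> g"] g supp by (simp add: one)
  qed (use g in simp)
  have ne: "\<Gamma> g \<noteq> \<zero>\<^bsub>R\<^esub>" "\<Gamma> h \<noteq> \<zero>\<^bsub>R\<^esub>" "\<Gamma> g \<otimes>\<^bsub>R\<^esub> \<Gamma> h \<noteq> \<zero>\<^bsub>R\<^esub>"
    if gh: "g \<in> carrier G" "h \<in> carrier G" and nz: "\<sigma> (g, h) \<noteq> \<zero>\<^bsub>K\<^esub>" for g h
  proof -
    show p: "\<Gamma> g \<otimes>\<^bsub>R\<^esub> \<Gamma> h \<noteq> \<zero>\<^bsub>R\<^esub>" using null gh nz by blast
    then show "\<Gamma> g \<noteq> \<zero>\<^bsub>R\<^esub>" "\<Gamma> h \<noteq> \<zero>\<^bsub>R\<^esub>" using gh by auto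
  qed
  show ?thesis
  proof unfold_locales
    have "\<one>\<^bsub>R\<^esub> = \<sigma> (\<one>\<^bsub>G\<^esub>, \<one>\<^bsub>G\<^esub>) \<odot>\<^bsub>R\<^esub> \<one>\<^bsub>R\<^esub>"
      using left[of "\<one>\<^bsub>G\<^esub>" "\<one>\<^bsub>G\<^esub>"] by (simp add: one)
    then show "\<sigma> (\<one>\<^bsub>G\<^esub>, \<one>\<^bsub>G\<^esub>) = \<one>\<^bsub>K\<^esub>"
      by (intro smult_cancel[OF K R, of _ _ "\<one>\<^bsub>R\<^esub>"]) (auto simp: A.one_neq_zero)
  next
    fix g h assume gh: "g \<in> carrier G" "h \<in> carrier G" and nz: "\<sigma> (g, h) \<noteq> \<zero>\<^bsub>K\<^esub>"
    note [simp] = gh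
    let ?p = "\<Gamma> g \<otimes>\<^bsub>R\<^esub> \<Gamma> h"
    show "\<sigma> (g, inv\<^bsub>G\<^esub> g) = \<one>\<^bsub>K\<^esub>" "\<sigma> (h, inv\<^bsub>G\<^esub> h) = \<one>\<^bsub>K\<^esub>"
      using ne(1,2)[OF gh nz] supp by auto
    \<comment> \<open>Condition (iv) is used at \<open>(g, h)\<close> and then at
      \<open>(inv g, gh)\<close>, which leads back to \<open>?p\<close>. Since \<open>?p\<close> is
      nonzero, the two scalars collected on the way multiply to one.\<close>
    have "?p = \<Gamma> g \<otimes>\<^bsub>R\<^esub> \<Gamma> (inv\<^bsub>G\<^esub> g) \<otimes>\<^bsub>R\<^esub> \<Gamma> g \<otimes>\<^bsub>R\<^esub> \<Gamma> h"
      by (simp add: von_Neumann)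
    also have "\<dots> = \<Gamma> g \<otimes>\<^bsub>R\<^esub> (\<Gamma> (inv\<^bsub>G\<^esub> g) \<otimes>\<^bsub>R\<^esub> \<Gamma> g \<otimes>\<^bsub>R\<^esub> \<Gamma> h)"
      by (simp add: A.R.m_assoc)
    also have "\<dots> = \<sigma> (g, h) \<odot>\<^bsub>R\<^esub> (\<Gamma> g \<otimes>\<^bsub>R\<^esub> \<Gamma> (inv\<^bsub>G\<^esub> g) \<otimes>\<^bsub>R\<^esub> \<Gamma> (g \<otimes>\<^bsub>G\<^esub> h))"
      by (subst left) (simp_all add: A.smult_mult_right A.R.m_assoc)
    also have "\<Gamma> g \<otimes>\<^bsub>R\<^esub> \<Gamma> (inv\<^bsub>G\<^esub> g) \<otimes>\<^bsub>R\<^esub> \<Gamma> (g \<otimes>\<^bsub>G\<^esub> h) = \<sigma> (inv\<^bsub>G\<^esub> g, g \<otimes>\<^bsub>G\<^esub> h) \<odot>\<^bsub>R\<^esub> ?p"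
      using left[of "inv\<^bsub>G\<^esub> g" "g \<otimes>\<^bsub>G\<^esub> h"] by (simp flip: G.m_assoc)
    finally have "\<one>\<^bsub>K\<^esub> \<odot>\<^bsub>R\<^esub> ?p = (\<sigma> (g, h) \<otimes>\<^bsub>K\<^esub> \<sigma> (inv\<^bsub>G\<^esub> g, g \<otimes>\<^bsub>G\<^esub> h)) \<odot>\<^bsub>R\<^esub> ?p"
      by (simp add: A.smult_assoc1)
    then show "\<sigma> (g, h) \<otimes>\<^bsub>K\<^esub> \<sigma> (inv\<^bsub>G\<^esub> g, g \<otimes>\<^bsub>G\<^esub> h) = \<one>\<^bsub>K\<^esub>"
      using ne(3)[OF gh nz] by (intro smult_cancel[OF K R, of _ _ ?p]) auto
    \<comment> \<open>The mirror image, with (v) at \<open>(g, h)\<close> and at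
      \<open>(gh, inv h)\<close>.\<close>
    have "?p = \<Gamma> g \<otimes>\<^bsub>R\<^esub> (\<Gamma> h \<otimes>\<^bsub>R\<^esub> \<Gamma> (inv\<^bsub>G\<^esub> h) \<otimes>\<^bsub>R\<^esub> \<Gamma> h)"
      by (simp add: von_Neumann)
    also have "\<dots> = \<Gamma> g \<otimes>\<^bsub>R\<^esub> \<Gamma> h \<otimes>\<^bsub>R\<^esub> \<Gamma> (inv\<^bsub>G\<^esub> h) \<otimes>\<^bsub>R\<^esub> \<Gamma> h"
      by (simp add: A.R.m_assoc)
    also have "\<dots> = \<sigma> (g, h) \<odot>\<^bsub>R\<^esub> (\<Gamma> (g \<otimes>\<^bsub>G\<^esub> h) \<otimes>\<^bsub>R\<^esub> \<Gamma> (inv\<^bsub>G\<^esub> h) \<otimes>\<^bsub>R\<^esub> \<Gamma> h)"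
      by (subst right) (simp_all add: A.smult_mult_left)
    also have "\<Gamma> (g \<otimes>\<^bsub>G\<^esub> h) \<otimes>\<^bsub>R\<^esub> \<Gamma> (inv\<^bsub>G\<^esub> h) \<otimes>\<^bsub>R\<^esub> \<Gamma> h = \<sigma> (g \<otimes>\<^bsub>G\<^esub> h, inv\<^bsub>G\<^esub> h) \<odot>\<^bsub>R\<^esub> ?p"
      using right[of "g \<otimes>\<^bsub>G\<^esub> h" "inv\<^bsub>G\<^esub> h"] by (simp add: G.m_assoc)
    finally have "\<one>\<^bsub>K\<^esub> \<odot>\<^bsub>R\<^esub> ?p = (\<sigma> (g, h) \<otimes>\<^bsub>K\<^esub> \<sigma> (g \<otimes>\<^bsub>G\<^esub> h, inv\<^bsub>G\<^esub> h)) \<odot>\<^bsub>R\<^esub> ?p"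
      by (simp add: A.smult_assoc1)
    then show "\<sigma> (g, h) \<otimes>\<^bsub>K\<^esub> \<sigma> (g \<otimes>\<^bsub>G\<^esub> h, inv\<^bsub>G\<^esub> h) = \<one>\<^bsub>K\<^esub>"
      using ne(3)[OF gh nz] by (intro smult_cancel[OF K R, of _ _ ?p]) auto
  qed (use norm in auto)
qed

section \<open>Representations on weighted points\<close>

definition endo_algebra ::
  "('k, 'm) ring_scheme \<Rightarrow> ('k, 'v, 'p) module_scheme \<Rightarrow> ('k, 'v \<Rightarrow> 'v) module" where
  "endo_algebra K M = \<lparr>carrier = {f \<in> carrier M \<rightarrow>\<^sub>E carrier M.
       (\<forall>x\<in>carrier M. \<forall>y\<in>carrier M. f (x \<oplus>\<^bsub>M\<^esub> y) = f x \<oplus>\<^bsub>M\<^esub> f y) \<and>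
       (\<forall>c\<in>carrier K. \<forall>x\<in>carrier M. f (c \<odot>\<^bsub>M\<^esub> x) = c \<odot>\<^bsub>M\<^esub> f x)},
     mult = compose (carrier M), one = (\<lambda>x\<in>carrier M. x),
     zero = (\<lambda>x\<in>carrier M. \<zero>\<^bsub>M\<^esub>), add = (\<lambda>f g. \<lambda>x\<in>carrier M. f x \<oplus>\<^bsub>M\<^esub> g x),
     smult = (\<lambda>c f. \<lambda>x\<in>carrier M. c \<odot>\<^bsub>M\<^esub> f x)\<rparr>"

lemma (in module) endo_algebra:
  assumes nt: "carrier M \<noteq> {\<zero>\<^bsub>M\<^esub>}"
  shows "unital_assoc_algebra R (endo_algebra R M)"
proof -
  let ?E = "endo_algebra R M"
  have ab: "abelian_group ?E"
  proof (rule abelian_groupI)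
    fix f assume f: "f \<in> carrier ?E"
    then have "f x \<in> carrier M" if "x \<in> carrier M" for x
      using that by (auto simp: endo_algebra_def)
    with f show "\<exists>g\<in>carrier ?E. g \<oplus>\<^bsub>?E\<^esub> f = \<zero>\<^bsub>?E\<^esub>"
      by (intro bexI[of _ "\<lambda>x\<in>carrier M. \<ominus>\<^bsub>M\<^esub> f x"])
        (auto simp: endo_algebra_def M.minus_add M.l_neg smult_r_minus intro!: restrict_ext)
  qed (auto simp: endo_algebra_def smult_r_distr M.a_ac PiE_iff
      intro!: restrict_ext intro: extensionalityI)
  have mon: "monoid ?E"
    by (rule monoidI)
      (auto simp: endo_algebra_def compose_def PiE_iff intro!: restrict_ext intro: extensionalityI)
  have ring: "ring ?E"
    by (rule ringI[OF ab mon])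
      (auto simp: endo_algebra_def compose_def PiE_iff intro!: restrict_ext intro: extensionalityI)
  have mod: "module R ?E"
    by (rule moduleI[OF R.cring_axioms ab])
      (auto simp: endo_algebra_def PiE_iff smult_l_distr smult_r_distr R.m_comm
        intro!: restrict_ext intro: extensionalityI simp flip: smult_assoc1)
  have "(\<lambda>x\<in>carrier M. x) \<noteq> (\<lambda>x\<in>carrier M. \<zero>\<^bsub>M\<^esub>)"
    using nt by (metis M.zero_closed restrict_apply' singletonD singletonI subsetI subset_antisym)
  then show ?thesis
    by (intro unital_assoc_algebra.intro unital_assoc_algebra_axioms.intro ring mod)
      (auto simp: endo_algebra_def compose_def PiE_iff intro!: restrict_ext intro: extensionalityI)
qed

text \<open>The full product of copies of \<open>K\<close>, with no finiteness condition on
  supports: the operators \<open>\<Gamma> g\<close> in \<open>rep_of_weights\<close> compute each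
  coordinate from a single one.\<close>

definition fun_module :: "('k, 'm) ring_scheme \<Rightarrow> 'i set \<Rightarrow> ('k, 'i \<Rightarrow> 'k) module" where
  "fun_module K I = \<lparr>carrier = I \<rightarrow>\<^sub>E carrier K,
     mult = undefined, one = undefined,
     zero = (\<lambda>i\<in>I. \<zero>\<^bsub>K\<^esub>), add = (\<lambda>v w. \<lambda>i\<in>I. v i \<oplus>\<^bsub>K\<^esub> w i),
     smult = (\<lambda>c v. \<lambda>i\<in>I. c \<otimes>\<^bsub>K\<^esub> v i)\<rparr>"

lemma (in cring) fun_module: "module R (fun_module R I)"
proof -
  have ab: "abelian_group (fun_module R I)"
  proof (rule abelian_groupI)
    fix v assume v: "v \<in> carrier (fun_module R I)"
    then have "v i \<in> carrier R" if "i \<in> I" for i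
      using that by (auto simp: fun_module_def)
    with v show "\<exists>w\<in>carrier (fun_module R I). w \<oplus>\<^bsub>fun_module R I\<^esub> v = \<zero>\<^bsub>fun_module R I\<^esub>"
      by (intro bexI[of _ "\<lambda>i\<in>I. \<ominus> v i"]) (auto simp: fun_module_def l_neg intro!: restrict_ext)
  qed (auto simp: fun_module_def PiE_iff a_ac intro!: restrict_ext intro: extensionalityI)
  show ?thesis
    by (rule moduleI[OF is_cring ab])
      (auto simp: fun_module_def PiE_iff l_distr r_distr m_assoc
        intro!: restrict_ext intro: extensionalityI)
qed


text \<open>The weight \<open>w p s t\<close> is the matrix entry of \<open>\<Gamma>(st\<^sup>-\<^sup>1)\<close> at \<open>(s, t)\<close> in the summand \<open>p\<close>.\<close>

lemma rep_of_weights: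
  fixes K :: "('k, 'm) ring_scheme" and G :: "('g, 'n) monoid_scheme" and J :: "'j set"
    and w :: "'j \<Rightarrow> 'g \<Rightarrow> 'g \<Rightarrow> 'k"
  assumes K: "field K" and G: "group G"
    and \<sigma>_closed: "\<And>g h. \<lbrakk>g \<in> carrier G; h \<in> carrier G\<rbrakk> \<Longrightarrow> \<sigma> (g, h) \<in> carrier K"
    and w_closed: "\<And>p s t. \<lbrakk>p \<in> J; s \<in> carrier G; t \<in> carrier G\<rbrakk> \<Longrightarrow> w p s t \<in> carrier K"
    and w_refl: "\<And>p s. \<lbrakk>p \<in> J; s \<in> carrier G\<rbrakk> \<Longrightarrow> w p s s = \<one>\<^bsub>K\<^esub>"
    and w_sym: "\<And>p s t. \<lbrakk>p \<in> J; s \<in> carrier G; t \<in> carrier G; w p s t \<noteq> \<zero>\<^bsub>K\<^esub>\<rbrakk>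
      \<Longrightarrow> w p t s \<noteq> \<zero>\<^bsub>K\<^esub>"
    and w_trans: "\<And>p s t u. \<lbrakk>p \<in> J; s \<in> carrier G; t \<in> carrier G; u \<in> carrier G;
        w p s t \<noteq> \<zero>\<^bsub>K\<^esub>; w p t u \<noteq> \<zero>\<^bsub>K\<^esub>\<rbrakk>
      \<Longrightarrow> w p s t \<otimes>\<^bsub>K\<^esub> w p t u
        = \<sigma> (s \<otimes>\<^bsub>G\<^esub> inv\<^bsub>G\<^esub> t, t \<otimes>\<^bsub>G\<^esub> inv\<^bsub>G\<^esub> u) \<otimes>\<^bsub>K\<^esub> w p s u"
    and w_supp: "\<And>g h. \<lbrakk>g \<in> carrier G; h \<in> carrier G; \<sigma> (g, h) \<noteq> \<zero>\<^bsub>K\<^esub>\<rbrakk> \<Longrightarrow> \<exists>p\<in>J. \<exists>u\<in>carrier G.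
        w p (g \<otimes>\<^bsub>G\<^esub> h \<otimes>\<^bsub>G\<^esub> u) (h \<otimes>\<^bsub>G\<^esub> u) \<noteq> \<zero>\<^bsub>K\<^esub> \<and> w p (h \<otimes>\<^bsub>G\<^esub> u) u \<noteq> \<zero>\<^bsub>K\<^esub>"
    and J: "J \<noteq> {}"
  shows "\<exists>(R :: ('k, ('j \<times> 'g \<Rightarrow> 'k) \<Rightarrow> ('j \<times> 'g \<Rightarrow> 'k)) module) \<Gamma>.
    unital_assoc_algebra K R \<and> partial_proj_rep K G R \<Gamma> \<sigma>"
proof -
  interpret K: field K by (rule K)
  interpret G: group G by (rule G)
  let ?I = "J \<times> carrier G"
  define V where "V = fun_module K ?I"
  define R where "R = endo_algebra K V"
  interpret V: module K V unfolding V_def by (rule K.fun_module)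
  \<comment> \<open>A nonempty \<open>J\<close> makes \<open>V\<close> nonzero, hence
    \<open>1\<close> and \<open>0\<close> distinct in its endomorphism algebra.\<close>
  have "(\<lambda>i\<in>?I. \<one>\<^bsub>K\<^esub>) \<noteq> (\<lambda>i\<in>?I. \<zero>\<^bsub>K\<^esub>)"
    using J by (auto simp: fun_eq_iff restrict_def intro!: exI[of _ "\<one>\<^bsub>G\<^esub>"])
  moreover have "(\<lambda>i\<in>?I. \<one>\<^bsub>K\<^esub>) \<in> carrier V" "\<zero>\<^bsub>V\<^esub> = (\<lambda>i\<in>?I. \<zero>\<^bsub>K\<^esub>)"
    by (auto simp: V_def fun_module_def)
  ultimately have alg: "unital_assoc_algebra K R"
    unfolding R_def by (intro V.endo_algebra) auto
  \<comment> \<open>In coordinates, the weighted translation that sends the point \<open>t\<close>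
    to \<open>gt\<close>: the coordinate at \<open>s\<close> is read off at
    \<open>inv g * s\<close>.\<close>
  define \<Gamma> where "\<Gamma> = (\<lambda>g. \<lambda>v\<in>carrier V. \<lambda>(p, s)\<in>?I.
    w p s (inv\<^bsub>G\<^esub> g \<otimes>\<^bsub>G\<^esub> s) \<otimes>\<^bsub>K\<^esub> v (p, inv\<^bsub>G\<^esub> g \<otimes>\<^bsub>G\<^esub> s))"
  have V_iff: "v \<in> carrier V \<longleftrightarrow> (\<forall>p\<in>J. \<forall>s\<in>carrier G. v (p, s) \<in> carrier K) \<and> v \<in> extensional ?I" for v
    by (auto simp: V_def fun_module_def PiE_iff)
  have \<Gamma>_V: "\<Gamma> g v \<in> carrier V" if "g \<in> carrier G" "v \<in> carrier V" for g v
    using that by (auto simp: \<Gamma>_def V_iff w_closed)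
  have \<Gamma>_apply: "\<Gamma> g v (p, s) = w p s (inv\<^bsub>G\<^esub> g \<otimes>\<^bsub>G\<^esub> s) \<otimes>\<^bsub>K\<^esub> v (p, inv\<^bsub>G\<^esub> g \<otimes>\<^bsub>G\<^esub> s)"
    if "v \<in> carrier V" "p \<in> J" "s \<in> carrier G" for g v p s
    using that by (simp add: \<Gamma>_def)
  have V_eqI: "v = v'" if "v \<in> carrier V" "v' \<in> carrier V"
    "\<And>p s. p \<in> J \<Longrightarrow> s \<in> carrier G \<Longrightarrow> v (p, s) = v' (p, s)" for v v'
    using that by (intro extensionalityI[of v ?I v']) (auto simp: V_iff)
  have V_K: "v (p, s) \<in> carrier K" if "v \<in> carrier V" "p \<in> J" "s \<in> carrier G" for v p s
    using that by (simp add: V_iff)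
  have add_apply: "(v \<oplus>\<^bsub>V\<^esub> v') (p, s) = v (p, s) \<oplus>\<^bsub>K\<^esub> v' (p, s)"
    and smult_apply: "(c \<odot>\<^bsub>V\<^esub> v) (p, s) = c \<otimes>\<^bsub>K\<^esub> v (p, s)"
    if "p \<in> J" "s \<in> carrier G" for v v' c p s
    using that by (simp_all add: V_def fun_module_def)
  have \<Gamma>_R: "\<Gamma> g \<in> carrier R" if g: "g \<in> carrier G" for g
  proof -
    have "\<Gamma> g (x \<oplus>\<^bsub>V\<^esub> y) = \<Gamma> g x \<oplus>\<^bsub>V\<^esub> \<Gamma> g y" if "x \<in> carrier V" "y \<in> carrier V" for x y
      by (rule V_eqI) (use that g in \<open>simp_all add: \<Gamma>_V \<Gamma>_apply add_apply V_K w_closed K.r_distr\<close>)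
    moreover have "\<Gamma> g (c \<odot>\<^bsub>V\<^esub> x) = c \<odot>\<^bsub>V\<^esub> \<Gamma> g x" if "c \<in> carrier K" "x \<in> carrier V" for c x
      by (rule V_eqI) (use that g in \<open>simp_all add: \<Gamma>_V \<Gamma>_apply smult_apply V_K w_closed K.m_lcomm\<close>)
    moreover have "\<Gamma> g \<in> extensional (carrier V)" by (simp add: \<Gamma>_def)
    ultimately show ?thesis
      using \<Gamma>_V[OF g] by (auto simp: R_def endo_algebra_def PiE_iff)
  qed
  have R_eqI: "f = f'" if f: "f \<in> carrier R" "f' \<in> carrier R"
    "\<And>v p s. v \<in> carrier V \<Longrightarrow> p \<in> J \<Longrightarrow> s \<in> carrier G \<Longrightarrow> f v (p, s) = f' v (p, s)" for f f'
  proof (rule extensionalityI[of f "carrier V" f'])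
    fix v assume "v \<in> carrier V"
    with f show "f v = f' v"
      by (intro V_eqI) (auto simp: R_def endo_algebra_def PiE_iff)
  qed (use f in \<open>auto simp: R_def endo_algebra_def PiE_iff\<close>)
  interpret A: unital_assoc_algebra K R by (rule alg)
  have mult_apply: "(f \<otimes>\<^bsub>R\<^esub> f') v = f (f' v)"
    and zero_apply: "p \<in> J \<Longrightarrow> s \<in> carrier G \<Longrightarrow> \<zero>\<^bsub>R\<^esub> v (p, s) = \<zero>\<^bsub>K\<^esub>"
    and one_apply: "\<one>\<^bsub>R\<^esub> v = v"
    and smult_R_apply: "p \<in> J \<Longrightarrow> s \<in> carrier G \<Longrightarrow> (c \<odot>\<^bsub>R\<^esub> f) v (p, s) = c \<otimes>\<^bsub>K\<^esub> f v (p, s)"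
    if "v \<in> carrier V" for f f' v c p s
    using that by (simp_all add: R_def endo_algebra_def compose_def V_def fun_module_def)
  have \<Gamma>_one: "\<Gamma> \<one>\<^bsub>G\<^esub> = \<one>\<^bsub>R\<^esub>"
    by (rule R_eqI) (simp_all add: \<Gamma>_R \<Gamma>_apply one_apply w_refl V_K)
  \<comment> \<open>In a field the left side of \<open>w_trans\<close> is nonzero, so both factors
    on its right side are. Thus \<open>w p s t \<noteq> 0\<close> is an equivalence relation on
    \<open>G\<close>, and \<open>\<sigma>\<close> is nonzero along its classes.\<close>
  have pair: "w p a c \<noteq> \<zero>\<^bsub>K\<^esub>" if "p \<in> J" "a \<in> carrier G" "b \<in> carrier G" "c \<in> carrier G"
    "w p a b \<noteq> \<zero>\<^bsub>K\<^esub>" "w p b c \<noteq> \<zero>\<^bsub>K\<^esub>" for p a b c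
    using w_trans[OF that] that by (auto simp: \<sigma>_closed w_closed K.integral_iff)
  have \<sigma>_nz: "\<sigma> (a \<otimes>\<^bsub>G\<^esub> inv\<^bsub>G\<^esub> b, b \<otimes>\<^bsub>G\<^esub> inv\<^bsub>G\<^esub> c) \<noteq> \<zero>\<^bsub>K\<^esub>"
    if "p \<in> J" "a \<in> carrier G" "b \<in> carrier G" "c \<in> carrier G"
      "w p a b \<noteq> \<zero>\<^bsub>K\<^esub>" "w p b c \<noteq> \<zero>\<^bsub>K\<^esub>" for p a b c
    using w_trans[OF that] that by (auto simp: w_closed K.integral_iff)
  \<comment> \<open>The composition law also holds with zero weights, as soon as one of the two
    steps is invertible: then \<open>a\<close> and \<open>c\<close> are related only if all three
    points are. The outermost factor in (iv) and in (v) supplies this reversed step.\<close>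
  have trans: "w p a b \<otimes>\<^bsub>K\<^esub> w p b c
      = \<sigma> (a \<otimes>\<^bsub>G\<^esub> inv\<^bsub>G\<^esub> b, b \<otimes>\<^bsub>G\<^esub> inv\<^bsub>G\<^esub> c) \<otimes>\<^bsub>K\<^esub> w p a c"
    if "p \<in> J" "a \<in> carrier G" "b \<in> carrier G" "c \<in> carrier G"
      "w p b a \<noteq> \<zero>\<^bsub>K\<^esub> \<or> w p c b \<noteq> \<zero>\<^bsub>K\<^esub>" for p a b c
  proof (cases "w p a b \<noteq> \<zero>\<^bsub>K\<^esub> \<and> w p b c \<noteq> \<zero>\<^bsub>K\<^esub>")
    case True
    then show ?thesis using w_trans that by blast
  next
    case False
    then have "w p a c = \<zero>\<^bsub>K\<^esub>" using that pair w_sym by metis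
    with False show ?thesis using that by (auto simp: w_closed \<sigma>_closed)
  qed
  have word: "(\<Gamma> g \<otimes>\<^bsub>R\<^esub> \<Gamma> h) v (p, s) = w p s (inv\<^bsub>G\<^esub> g \<otimes>\<^bsub>G\<^esub> s) \<otimes>\<^bsub>K\<^esub>
      (w p (inv\<^bsub>G\<^esub> g \<otimes>\<^bsub>G\<^esub> s) (inv\<^bsub>G\<^esub> h \<otimes>\<^bsub>G\<^esub> (inv\<^bsub>G\<^esub> g \<otimes>\<^bsub>G\<^esub> s)) \<otimes>\<^bsub>K\<^esub>
        v (p, inv\<^bsub>G\<^esub> h \<otimes>\<^bsub>G\<^esub> (inv\<^bsub>G\<^esub> g \<otimes>\<^bsub>G\<^esub> s)))"
    if "g \<in> carrier G" "h \<in> carrier G" "v \<in> carrier V" "p \<in> J" "s \<in> carrier G" for g h v p s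
    using that by (simp add: mult_apply \<Gamma>_apply \<Gamma>_V)
  have "partial_proj_rep K G R \<Gamma> \<sigma>"
    unfolding partial_proj_rep_def
  proof (intro conjI ballI impI)
    show "\<Gamma> \<in> carrier G \<rightarrow> carrier R" "\<sigma> \<in> carrier G \<times> carrier G \<rightarrow> carrier K"
      using \<Gamma>_R \<sigma>_closed by auto
    show "\<Gamma> \<one>\<^bsub>G\<^esub> = \<one>\<^bsub>R\<^esub>" by (rule \<Gamma>_one)
  next
    fix g h assume gh: "g \<in> carrier G" "h \<in> carrier G"
    note [simp] = gh \<Gamma>_R w_closed \<sigma>_closed V_K
    have cancel: "x \<otimes>\<^bsub>G\<^esub> (inv\<^bsub>G\<^esub> x \<otimes>\<^bsub>G\<^esub> y) = y" "inv\<^bsub>G\<^esub> x \<otimes>\<^bsub>G\<^esub> (x \<otimes>\<^bsub>G\<^esub> y) = y"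
      if "x \<in> carrier G" "y \<in> carrier G" for x y
      using that by (simp_all flip: G.m_assoc)
    have ih: "inv\<^bsub>G\<^esub> (g \<otimes>\<^bsub>G\<^esub> h) \<otimes>\<^bsub>G\<^esub> (g \<otimes>\<^bsub>G\<^esub> s) = inv\<^bsub>G\<^esub> h \<otimes>\<^bsub>G\<^esub> s"
      "inv\<^bsub>G\<^esub> g \<otimes>\<^bsub>G\<^esub> (g \<otimes>\<^bsub>G\<^esub> s) = s" "h \<otimes>\<^bsub>G\<^esub> (inv\<^bsub>G\<^esub> h \<otimes>\<^bsub>G\<^esub> s) = s"
      "h \<otimes>\<^bsub>G\<^esub> (inv\<^bsub>G\<^esub> (g \<otimes>\<^bsub>G\<^esub> h) \<otimes>\<^bsub>G\<^esub> s) = inv\<^bsub>G\<^esub> g \<otimes>\<^bsub>G\<^esub> s"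
      "g \<otimes>\<^bsub>G\<^esub> s \<otimes>\<^bsub>G\<^esub> inv\<^bsub>G\<^esub> s = g" "s \<otimes>\<^bsub>G\<^esub> inv\<^bsub>G\<^esub> (inv\<^bsub>G\<^esub> h \<otimes>\<^bsub>G\<^esub> s) = h"
      "s \<otimes>\<^bsub>G\<^esub> inv\<^bsub>G\<^esub> (inv\<^bsub>G\<^esub> g \<otimes>\<^bsub>G\<^esub> s) = g"
      "inv\<^bsub>G\<^esub> g \<otimes>\<^bsub>G\<^esub> s \<otimes>\<^bsub>G\<^esub> inv\<^bsub>G\<^esub> (inv\<^bsub>G\<^esub> (g \<otimes>\<^bsub>G\<^esub> h) \<otimes>\<^bsub>G\<^esub> s) = h"
      "inv\<^bsub>G\<^esub> h \<otimes>\<^bsub>G\<^esub> (inv\<^bsub>G\<^esub> g \<otimes>\<^bsub>G\<^esub> s) = inv\<^bsub>G\<^esub> (g \<otimes>\<^bsub>G\<^esub> h) \<otimes>\<^bsub>G\<^esub> s"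
      if "s \<in> carrier G" for s
      using that by (simp_all add: G.inv_mult_group G.m_assoc cancel)
    show "\<Gamma> (inv\<^bsub>G\<^esub> g) \<otimes>\<^bsub>R\<^esub> \<Gamma> (g \<otimes>\<^bsub>G\<^esub> h) = \<zero>\<^bsub>R\<^esub>" if z: "\<sigma> (g, h) = \<zero>\<^bsub>K\<^esub>"
    proof (rule R_eqI)
      fix v p s assume vps: "v \<in> carrier V" "p \<in> J" "s \<in> carrier G"
      \<comment> \<open>With both weights nonzero, \<open>inv h * s\<close>, \<open>s\<close> and
        \<open>g * s\<close> would lie in one class, and the path through them would force
        \<open>\<sigma> (g, h) \<noteq> 0\<close>.\<close>
      have "w p s (g \<otimes>\<^bsub>G\<^esub> s) = \<zero>\<^bsub>K\<^esub> \<or> w p (g \<otimes>\<^bsub>G\<^esub> s) (inv\<^bsub>G\<^esub> h \<otimes>\<^bsub>G\<^esub> s) = \<zero>\<^bsub>K\<^esub>"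
        using \<sigma>_nz[of p "g \<otimes>\<^bsub>G\<^esub> s" s "inv\<^bsub>G\<^esub> h \<otimes>\<^bsub>G\<^esub> s"]
          pair[of p s "g \<otimes>\<^bsub>G\<^esub> s" "inv\<^bsub>G\<^esub> h \<otimes>\<^bsub>G\<^esub> s"] w_sym[of p s "g \<otimes>\<^bsub>G\<^esub> s"] vps z
        by (auto simp: ih)
      then show "(\<Gamma> (inv\<^bsub>G\<^esub> g) \<otimes>\<^bsub>R\<^esub> \<Gamma> (g \<otimes>\<^bsub>G\<^esub> h)) v (p, s) = \<zero>\<^bsub>R\<^esub> v (p, s)"
        using vps by (auto simp: word ih zero_apply)
    qed simp_all
    show "\<Gamma> (g \<otimes>\<^bsub>G\<^esub> h) \<otimes>\<^bsub>R\<^esub> \<Gamma> (inv\<^bsub>G\<^esub> h) = \<zero>\<^bsub>R\<^esub>" if z: "\<sigma> (g, h) = \<zero>\<^bsub>K\<^esub>"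
    proof (rule R_eqI)
      fix v p s assume vps: "v \<in> carrier V" "p \<in> J" "s \<in> carrier G"
      let ?b = "inv\<^bsub>G\<^esub> g \<otimes>\<^bsub>G\<^esub> s" and ?c = "inv\<^bsub>G\<^esub> (g \<otimes>\<^bsub>G\<^esub> h) \<otimes>\<^bsub>G\<^esub> s"
      have "w p s ?c = \<zero>\<^bsub>K\<^esub> \<or> w p ?c ?b = \<zero>\<^bsub>K\<^esub>"
        using \<sigma>_nz[of p s ?b ?c] pair[of p s ?c ?b] w_sym[of p ?c ?b] vps z
        by (auto simp: ih)
      then show "(\<Gamma> (g \<otimes>\<^bsub>G\<^esub> h) \<otimes>\<^bsub>R\<^esub> \<Gamma> (inv\<^bsub>G\<^esub> h)) v (p, s) = \<zero>\<^bsub>R\<^esub> v (p, s)"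
        using vps by (auto simp: word ih zero_apply)
    qed simp_all
    show "\<sigma> (g, h) = \<zero>\<^bsub>K\<^esub>" if z: "\<Gamma> g \<otimes>\<^bsub>R\<^esub> \<Gamma> h = \<zero>\<^bsub>R\<^esub>"
    proof (rule ccontr)
      assume "\<sigma> (g, h) \<noteq> \<zero>\<^bsub>K\<^esub>"
      then obtain p u where pu: "p \<in> J" "u \<in> carrier G"
        "w p (g \<otimes>\<^bsub>G\<^esub> h \<otimes>\<^bsub>G\<^esub> u) (h \<otimes>\<^bsub>G\<^esub> u) \<noteq> \<zero>\<^bsub>K\<^esub>" "w p (h \<otimes>\<^bsub>G\<^esub> u) u \<noteq> \<zero>\<^bsub>K\<^esub>"
        using w_supp gh by blast
      \<comment> \<open>No basis vector is needed to detect the nonzero entry: every coordinate of a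
        word applied to the all-ones vector is one single product of weights.\<close>
      let ?v = "\<lambda>i\<in>?I. \<one>\<^bsub>K\<^esub>"
      have v: "?v \<in> carrier V" by (simp add: V_iff)
      have "inv\<^bsub>G\<^esub> g \<otimes>\<^bsub>G\<^esub> (g \<otimes>\<^bsub>G\<^esub> h \<otimes>\<^bsub>G\<^esub> u) = h \<otimes>\<^bsub>G\<^esub> u" "inv\<^bsub>G\<^esub> h \<otimes>\<^bsub>G\<^esub> (h \<otimes>\<^bsub>G\<^esub> u) = u"
        using pu by (simp_all flip: G.m_assoc)
      then have "(\<Gamma> g \<otimes>\<^bsub>R\<^esub> \<Gamma> h) ?v (p, g \<otimes>\<^bsub>G\<^esub> h \<otimes>\<^bsub>G\<^esub> u) \<noteq> \<zero>\<^bsub>K\<^esub>"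
        using pu v by (subst word) (simp_all add: K.integral_iff)
      then show False using z pu v by (simp add: zero_apply)
    qed
    show "\<Gamma> (inv\<^bsub>G\<^esub> g) \<otimes>\<^bsub>R\<^esub> \<Gamma> g \<otimes>\<^bsub>R\<^esub> \<Gamma> h
        = \<sigma> (g, h) \<odot>\<^bsub>R\<^esub> (\<Gamma> (inv\<^bsub>G\<^esub> g) \<otimes>\<^bsub>R\<^esub> \<Gamma> (g \<otimes>\<^bsub>G\<^esub> h))"
    proof (rule R_eqI)
      fix v p s assume vps: "v \<in> carrier V" "p \<in> J" "s \<in> carrier G"
      let ?a = "g \<otimes>\<^bsub>G\<^esub> s" and ?c = "inv\<^bsub>G\<^esub> h \<otimes>\<^bsub>G\<^esub> s"
      have "w p s ?a \<otimes>\<^bsub>K\<^esub> (w p ?a s \<otimes>\<^bsub>K\<^esub> w p s ?c)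
          = w p s ?a \<otimes>\<^bsub>K\<^esub> (\<sigma> (g, h) \<otimes>\<^bsub>K\<^esub> w p ?a ?c)"
        using trans[of p ?a s ?c] vps by (cases "w p s ?a = \<zero>\<^bsub>K\<^esub>") (auto simp: ih)
      then show "(\<Gamma> (inv\<^bsub>G\<^esub> g) \<otimes>\<^bsub>R\<^esub> \<Gamma> g \<otimes>\<^bsub>R\<^esub> \<Gamma> h) v (p, s)
          = (\<sigma> (g, h) \<odot>\<^bsub>R\<^esub> (\<Gamma> (inv\<^bsub>G\<^esub> g) \<otimes>\<^bsub>R\<^esub> \<Gamma> (g \<otimes>\<^bsub>G\<^esub> h))) v (p, s)"
        using vps by (simp add: mult_apply[of _ "_ \<otimes>\<^bsub>R\<^esub> _"] mult_apply smult_R_apply \<Gamma>_apply \<Gamma>_V ih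
            K.m_lcomm flip: K.m_assoc)
    qed simp_all
    show "\<Gamma> g \<otimes>\<^bsub>R\<^esub> \<Gamma> h \<otimes>\<^bsub>R\<^esub> \<Gamma> (inv\<^bsub>G\<^esub> h)
        = \<sigma> (g, h) \<odot>\<^bsub>R\<^esub> (\<Gamma> (g \<otimes>\<^bsub>G\<^esub> h) \<otimes>\<^bsub>R\<^esub> \<Gamma> (inv\<^bsub>G\<^esub> h))"
    proof (rule R_eqI)
      fix v p s assume vps: "v \<in> carrier V" "p \<in> J" "s \<in> carrier G"
      let ?b = "inv\<^bsub>G\<^esub> g \<otimes>\<^bsub>G\<^esub> s" and ?c = "inv\<^bsub>G\<^esub> (g \<otimes>\<^bsub>G\<^esub> h) \<otimes>\<^bsub>G\<^esub> s"
      have "(w p s ?b \<otimes>\<^bsub>K\<^esub> w p ?b ?c) \<otimes>\<^bsub>K\<^esub> w p ?c ?b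
          = (\<sigma> (g, h) \<otimes>\<^bsub>K\<^esub> w p s ?c) \<otimes>\<^bsub>K\<^esub> w p ?c ?b"
        using trans[of p s ?b ?c] vps by (cases "w p ?c ?b = \<zero>\<^bsub>K\<^esub>") (auto simp: ih)
      then show "(\<Gamma> g \<otimes>\<^bsub>R\<^esub> \<Gamma> h \<otimes>\<^bsub>R\<^esub> \<Gamma> (inv\<^bsub>G\<^esub> h)) v (p, s)
          = (\<sigma> (g, h) \<odot>\<^bsub>R\<^esub> (\<Gamma> (g \<otimes>\<^bsub>G\<^esub> h) \<otimes>\<^bsub>R\<^esub> \<Gamma> (inv\<^bsub>G\<^esub> h))) v (p, s)"
        using vps by (simp add: mult_apply smult_R_apply \<Gamma>_apply \<Gamma>_V ih flip: K.m_assoc)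
    qed simp_all
  qed
  with alg show ?thesis by blast
qed

section \<open>The symmetry of a twist and its triangle representation\<close>

context normalized_twist
begin

lemma cancel_left:
  assumes "x \<in> carrier G" "y \<in> carrier G"
  shows "x \<otimes>\<^bsub>G\<^esub> (inv\<^bsub>G\<^esub> x \<otimes>\<^bsub>G\<^esub> y) = y" "inv\<^bsub>G\<^esub> x \<otimes>\<^bsub>G\<^esub> (x \<otimes>\<^bsub>G\<^esub> y) = y"
  using assms by (simp_all flip: G.m_assoc)

text \<open>The map \<open>(g, h) \<mapsto> (inv g, gh)\<close> is an involution, so the
  invertibility in \<open>twist_left\<close> transports nonvanishing in both directions.\<close>

lemma twist_left_eq_zero_iff:
  assumes "g \<in> carrier G" "h \<in> carrier G"
  shows "\<sigma> (inv\<^bsub>G\<^esub> g, g \<otimes>\<^bsub>G\<^esub> h) = \<zero>\<^bsub>K\<^esub> \<longleftrightarrow> \<sigma> (g, h) = \<zero>\<^bsub>K\<^esub>"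
  using twist_left[of g h] twist_left[of "inv\<^bsub>G\<^esub> g" "g \<otimes>\<^bsub>G\<^esub> h"] assms
  by (cases "\<sigma> (g, h) = \<zero>\<^bsub>K\<^esub>"; cases "\<sigma> (inv\<^bsub>G\<^esub> g, g \<otimes>\<^bsub>G\<^esub> h) = \<zero>\<^bsub>K\<^esub>")
    (auto simp: cancel_left twist_closed)

lemma twist_right_eq_zero_iff:
  assumes "g \<in> carrier G" "h \<in> carrier G"
  shows "\<sigma> (g \<otimes>\<^bsub>G\<^esub> h, inv\<^bsub>G\<^esub> h) = \<zero>\<^bsub>K\<^esub> \<longleftrightarrow> \<sigma> (g, h) = \<zero>\<^bsub>K\<^esub>"
  using twist_right[of g h] twist_right[of "g \<otimes>\<^bsub>G\<^esub> h" "inv\<^bsub>G\<^esub> h"] assms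
  by (cases "\<sigma> (g, h) = \<zero>\<^bsub>K\<^esub>"; cases "\<sigma> (g \<otimes>\<^bsub>G\<^esub> h, inv\<^bsub>G\<^esub> h) = \<zero>\<^bsub>K\<^esub>")
    (auto simp: G.m_assoc twist_closed)

lemma twist_left_eq:
  assumes "g \<in> carrier G" "h \<in> carrier G"
  shows "\<sigma> (inv\<^bsub>G\<^esub> g, g \<otimes>\<^bsub>G\<^esub> h) = (if \<sigma> (g, h) = \<zero>\<^bsub>K\<^esub> then \<zero>\<^bsub>K\<^esub> else inv\<^bsub>K\<^esub> \<sigma> (g, h))"
  using twist_left_eq_zero_iff[of g h] twist_left[of g h] assms
  by (auto simp: twist_closed intro!: K.comm_inv_char[symmetric])

lemma twist_right_eq:
  assumes "g \<in> carrier G" "h \<in> carrier G"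
  shows "\<sigma> (g \<otimes>\<^bsub>G\<^esub> h, inv\<^bsub>G\<^esub> h) = (if \<sigma> (g, h) = \<zero>\<^bsub>K\<^esub> then \<zero>\<^bsub>K\<^esub> else inv\<^bsub>K\<^esub> \<sigma> (g, h))"
  using twist_right_eq_zero_iff[of g h] twist_right[of g h] assms
  by (auto simp: twist_closed intro!: K.comm_inv_char[symmetric])

text \<open>The right involution followed by the left one sends \<open>(g, h)\<close> to this pair;
  \<open>\<sigma>\<close> is inverted twice and hence unchanged. The composite is the rotation of
  order three.\<close>

lemma twist_rotate:
  assumes "g \<in> carrier G" "h \<in> carrier G"
  shows "\<sigma> (inv\<^bsub>G\<^esub> (g \<otimes>\<^bsub>G\<^esub> h), g) = \<sigma> (g, h)"
  using twist_left_eq[of "g \<otimes>\<^bsub>G\<^esub> h" "inv\<^bsub>G\<^esub> h"] twist_right_eq[of g h]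
    twist_right_eq_zero_iff[of g h] assms
  by (auto simp: G.m_assoc twist_closed K.field_Units)

lemma twist_rotate':
  assumes "g \<in> carrier G" "h \<in> carrier G"
  shows "\<sigma> (h, inv\<^bsub>G\<^esub> (g \<otimes>\<^bsub>G\<^esub> h)) = \<sigma> (g, h)"
  using twist_rotate[of "inv\<^bsub>G\<^esub> (g \<otimes>\<^bsub>G\<^esub> h)" g] twist_rotate[of g h] assms
  by (simp add: G.inv_mult_group G.m_assoc)

text \<open>The product \<open>gh\<close> is the first entry of the right partner
  \<open>(gh, inv h)\<close>, so \<open>twist_supp_left\<close> applies there.\<close>

lemma twist_supp_mult:
  assumes "g \<in> carrier G" "h \<in> carrier G" "\<sigma> (g, h) \<noteq> \<zero>\<^bsub>K\<^esub>"
  shows "\<sigma> (g \<otimes>\<^bsub>G\<^esub> h, inv\<^bsub>G\<^esub> (g \<otimes>\<^bsub>G\<^esub> h)) = \<one>\<^bsub>K\<^esub>"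
  using twist_supp_left[of "g \<otimes>\<^bsub>G\<^esub> h" "inv\<^bsub>G\<^esub> h"] twist_right_eq_zero_iff[of g h] assms by auto

lemma twist_inv_commute:
  assumes g: "g \<in> carrier G"
  shows "\<sigma> (inv\<^bsub>G\<^esub> g, g) = \<sigma> (g, inv\<^bsub>G\<^esub> g)"
  using twist_supp_right[of g "inv\<^bsub>G\<^esub> g"] twist_supp_right[of "inv\<^bsub>G\<^esub> g" g]
    twist_inv[OF g] twist_inv[of "inv\<^bsub>G\<^esub> g"] g
  by auto

text \<open>Both pairs lie on one rotation orbit. So the degenerate pairs only record whether
  \<open>g\<close> is live, that is, whether \<open>\<sigma> (g, inv g)\<close> is one.\<close>

lemma twist_one_left: "g \<in> carrier G \<Longrightarrow> \<sigma> (\<one>\<^bsub>G\<^esub>, g) = \<sigma> (g, inv\<^bsub>G\<^esub> g)"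
  using twist_rotate[of g "inv\<^bsub>G\<^esub> g"] by simp

lemma twist_one_right: "g \<in> carrier G \<Longrightarrow> \<sigma> (g, \<one>\<^bsub>G\<^esub>) = \<sigma> (g, inv\<^bsub>G\<^esub> g)"
  using twist_rotate'[of "inv\<^bsub>G\<^esub> g" g] twist_inv_commute by simp

lemma twist_trivial:
  assumes "g \<in> carrier G" "\<sigma> (g, inv\<^bsub>G\<^esub> g) = \<one>\<^bsub>K\<^esub>"
  shows "\<sigma> (\<one>\<^bsub>G\<^esub>, g) = \<one>\<^bsub>K\<^esub>" "\<sigma> (g, \<one>\<^bsub>G\<^esub>) = \<one>\<^bsub>K\<^esub>" "\<sigma> (inv\<^bsub>G\<^esub> g, g) = \<one>\<^bsub>K\<^esub>"
  using assms by (simp_all add: twist_one_left twist_one_right twist_inv_commute)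

text \<open>The empty triangle lets null pairs index summands too; on these only
  \<open>\<Gamma> 1\<close> acts by a nonzero operator.\<close>

definition triangle :: "'g \<times> 'g \<Rightarrow> 'g set" where
  "triangle = (\<lambda>(g, h). if \<sigma> (g, h) = \<zero>\<^bsub>K\<^esub> then {} else {g \<otimes>\<^bsub>G\<^esub> h, h, \<one>\<^bsub>G\<^esub>})"

text \<open>The clause \<open>s = t\<close> lets \<open>\<Gamma>(1)\<close> act as the identity also at the points outside the triangle.\<close>

definition weight :: "'g \<times> 'g \<Rightarrow> 'g \<Rightarrow> 'g \<Rightarrow> 'k" where
  "weight p s t = (if s = t then \<one>\<^bsub>K\<^esub>
     else if s \<in> triangle p \<and> t \<in> triangle p then \<sigma> (s \<otimes>\<^bsub>G\<^esub> inv\<^bsub>G\<^esub> t, t) else \<zero>\<^bsub>K\<^esub>)"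

text \<open>Between \<open>h\<close> and \<open>gh\<close> the edges are \<open>(g, h)\<close> and
  its left partner \<open>(inv g, gh)\<close>. All other edges are degenerate pairs, and
  \<open>h\<close> and \<open>gh\<close> are live.\<close>

lemma triangle_nonzero:
  assumes p: "p \<in> carrier G \<times> carrier G" and st: "s \<in> triangle p" "t \<in> triangle p"
  shows "\<sigma> (s \<otimes>\<^bsub>G\<^esub> inv\<^bsub>G\<^esub> t, t) \<noteq> \<zero>\<^bsub>K\<^esub>"
proof -
  obtain g h where gh: "p = (g, h)" by (cases p)
  with p st have gh: "p = (g, h)" "g \<in> carrier G" "h \<in> carrier G" "\<sigma> (g, h) \<noteq> \<zero>\<^bsub>K\<^esub>"
    "s \<in> {g \<otimes>\<^bsub>G\<^esub> h, h, \<one>\<^bsub>G\<^esub>}" "t \<in> {g \<otimes>\<^bsub>G\<^esub> h, h, \<one>\<^bsub>G\<^esub>}"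
    by (auto simp: triangle_def split: if_splits)
  note [simp] = gh(2,3,4) twist_supp_mult[OF gh(2,3,4)] twist_supp_right[OF gh(2,3,4)] twist_one
  have [simp]: "h \<otimes>\<^bsub>G\<^esub> inv\<^bsub>G\<^esub> (g \<otimes>\<^bsub>G\<^esub> h) = inv\<^bsub>G\<^esub> g"
    by (simp add: G.inv_mult_group cancel_left)
  have [simp]: "g \<otimes>\<^bsub>G\<^esub> h \<otimes>\<^bsub>G\<^esub> inv\<^bsub>G\<^esub> h = g" by (simp add: G.m_assoc)
  show ?thesis
    using gh(5,6) by (auto simp: twist_trivial twist_left_eq_zero_iff)
qed

lemma triangle_closed: "p \<in> carrier G \<times> carrier G \<Longrightarrow> triangle p \<subseteq> carrier G"
  by (auto simp: triangle_def split: if_splits)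

lemma weight_nonzero_iff:
  assumes "p \<in> carrier G \<times> carrier G"
  shows "weight p s t \<noteq> \<zero>\<^bsub>K\<^esub> \<longleftrightarrow> s = t \<or> s \<in> triangle p \<and> t \<in> triangle p"
  using triangle_nonzero[OF assms] by (auto simp: weight_def)

text \<open>This is the cocycle identity restricted to one triangle. Among only three points, one of
  them the identity, it needs nothing beyond the symmetry of \<open>\<sigma>\<close>.\<close>

lemma weight_trans:
  assumes p: "p \<in> carrier G \<times> carrier G"
    and stu: "s \<in> carrier G" "t \<in> carrier G" "u \<in> carrier G"
    and nz: "weight p s t \<noteq> \<zero>\<^bsub>K\<^esub>" "weight p t u \<noteq> \<zero>\<^bsub>K\<^esub>"
  shows "weight p s t \<otimes>\<^bsub>K\<^esub> weight p t u
    = \<sigma> (s \<otimes>\<^bsub>G\<^esub> inv\<^bsub>G\<^esub> t, t \<otimes>\<^bsub>G\<^esub> inv\<^bsub>G\<^esub> u) \<otimes>\<^bsub>K\<^esub> weight p s u"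
proof -
  note [simp] = stu twist_closed
  have supp: "\<sigma> (x \<otimes>\<^bsub>G\<^esub> inv\<^bsub>G\<^esub> y, inv\<^bsub>G\<^esub> (x \<otimes>\<^bsub>G\<^esub> inv\<^bsub>G\<^esub> y)) = \<one>\<^bsub>K\<^esub>" if "weight p x y \<noteq> \<zero>\<^bsub>K\<^esub>"
    "x \<in> carrier G" "y \<in> carrier G" for x y
    using that twist_supp_left[of "x \<otimes>\<^bsub>G\<^esub> inv\<^bsub>G\<^esub> y" y] triangle_nonzero[OF p, of x y]
    by (auto simp: weight_nonzero_iff[OF p] twist_one)
  have closed [simp]: "weight p x y \<in> carrier K" if "x \<in> carrier G" "y \<in> carrier G" for x y
    using that by (simp add: weight_def)
  consider (st) "s = t" | (tu) "t = u" | (su) "s = u" "s \<noteq> t" | (distinct) "s \<noteq> t" "t \<noteq> u" "s \<noteq> u"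
    by blast
  then show ?thesis
  proof cases
    case st
    then show ?thesis
      using supp[OF nz(2)] by (simp add: twist_trivial weight_def[of p t t])
  next
    case tu
    then show ?thesis
      using supp[OF nz(1)] by (simp add: twist_trivial weight_def[of p u u])
  next
    case su
    then have T: "s \<in> triangle p" "t \<in> triangle p" using nz by (auto simp: weight_nonzero_iff[OF p])
    have i: "inv\<^bsub>G\<^esub> (s \<otimes>\<^bsub>G\<^esub> inv\<^bsub>G\<^esub> t) = t \<otimes>\<^bsub>G\<^esub> inv\<^bsub>G\<^esub> s"
      by (simp add: G.inv_mult_group)
    \<comment> \<open>Reversing an edge of the triangle is the left involution.\<close>
    have "\<sigma> (s \<otimes>\<^bsub>G\<^esub> inv\<^bsub>G\<^esub> t, t) \<otimes>\<^bsub>K\<^esub> \<sigma> (t \<otimes>\<^bsub>G\<^esub> inv\<^bsub>G\<^esub> s, s) = \<one>\<^bsub>K\<^esub>"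
      using twist_left[of "s \<otimes>\<^bsub>G\<^esub> inv\<^bsub>G\<^esub> t" t] triangle_nonzero[OF p T] by (simp add: i G.m_assoc)
    moreover have "\<sigma> (s \<otimes>\<^bsub>G\<^esub> inv\<^bsub>G\<^esub> t, t \<otimes>\<^bsub>G\<^esub> inv\<^bsub>G\<^esub> s) = \<one>\<^bsub>K\<^esub>"
      using supp[OF nz(1)] by (simp add: i)
    ultimately show ?thesis
      using su(2) T by (simp add: weight_def flip: su(1))
  next
    case distinct
    then have T: "s \<in> triangle p" "t \<in> triangle p" "u \<in> triangle p"
      using nz by (auto simp: weight_nonzero_iff[OF p])
    \<comment> \<open>Three distinct points exhaust the triangle.\<close>
    then have "s = \<one>\<^bsub>G\<^esub> \<or> t = \<one>\<^bsub>G\<^esub> \<or> u = \<one>\<^bsub>G\<^esub>"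
      using distinct by (auto simp: triangle_def split: prod.splits if_splits)
    moreover have one: "\<one>\<^bsub>G\<^esub> \<in> triangle p"
      using T by (auto simp: triangle_def split: prod.splits if_splits)
    then have live: "\<sigma> (x, inv\<^bsub>G\<^esub> x) = \<one>\<^bsub>K\<^esub>" if "x \<in> triangle p" for x
      using triangle_nonzero[OF p that one] twist_supp_left[of x "\<one>\<^bsub>G\<^esub>"]
        that triangle_closed[OF p] by auto
    ultimately consider "s = \<one>\<^bsub>G\<^esub>" | "t = \<one>\<^bsub>G\<^esub>" | "u = \<one>\<^bsub>G\<^esub>" by blast
    \<comment> \<open>Once the degenerate pairs are evaluated, what remains is the rotation of
      \<open>(t * inv u, u)\<close> for \<open>s = 1\<close>, the right symmetry at
      \<open>(s, inv u)\<close> for \<open>t = 1\<close>, and a trivial equation for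
      \<open>u = 1\<close>.\<close>
    then have "\<sigma> (s \<otimes>\<^bsub>G\<^esub> inv\<^bsub>G\<^esub> t, t) \<otimes>\<^bsub>K\<^esub> \<sigma> (t \<otimes>\<^bsub>G\<^esub> inv\<^bsub>G\<^esub> u, u)
      = \<sigma> (s \<otimes>\<^bsub>G\<^esub> inv\<^bsub>G\<^esub> t, t \<otimes>\<^bsub>G\<^esub> inv\<^bsub>G\<^esub> u) \<otimes>\<^bsub>K\<^esub> \<sigma> (s \<otimes>\<^bsub>G\<^esub> inv\<^bsub>G\<^esub> u, u)"
    proof cases
      case 1
      then show ?thesis
        using twist_rotate[of "t \<otimes>\<^bsub>G\<^esub> inv\<^bsub>G\<^esub> u" u] live T by (simp add: G.m_assoc twist_trivial)
    next
      case 2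
      have "\<sigma> (s, inv\<^bsub>G\<^esub> u) \<otimes>\<^bsub>K\<^esub> \<sigma> (s \<otimes>\<^bsub>G\<^esub> inv\<^bsub>G\<^esub> u, u) = \<one>\<^bsub>K\<^esub>"
        using twist_right[of s "inv\<^bsub>G\<^esub> u"] triangle_nonzero[OF p T(1,3)]
          twist_right_eq_zero_iff[of s "inv\<^bsub>G\<^esub> u"] by simp
      then show ?thesis using 2 live T by (simp add: twist_trivial)
    next
      case 3
      then show ?thesis using live T by (simp add: twist_trivial)
    qed
    then show ?thesis using distinct T by (simp add: weight_def)
  qed
qed

lemma twist_rep:
  "\<exists>(R :: ('k, (('g \<times> 'g) \<times> 'g \<Rightarrow> 'k) \<Rightarrow> (('g \<times> 'g) \<times> 'g \<Rightarrow> 'k)) module) \<Gamma>.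
    unital_assoc_algebra K R \<and> partial_proj_rep K G R \<Gamma> \<sigma>"
proof (rule rep_of_weights[where w = weight and J = "carrier G \<times> carrier G"])
  fix g h assume gh: "g \<in> carrier G" "h \<in> carrier G" "\<sigma> (g, h) \<noteq> \<zero>\<^bsub>K\<^esub>"
  then show "\<exists>p\<in>carrier G \<times> carrier G. \<exists>u\<in>carrier G.
    weight p (g \<otimes>\<^bsub>G\<^esub> h \<otimes>\<^bsub>G\<^esub> u) (h \<otimes>\<^bsub>G\<^esub> u) \<noteq> \<zero>\<^bsub>K\<^esub> \<and> weight p (h \<otimes>\<^bsub>G\<^esub> u) u \<noteq> \<zero>\<^bsub>K\<^esub>"
    \<comment> \<open>The summand indexed by \<open>(g, h)\<close> itself contains the path from
      \<open>1\<close> through \<open>h\<close> to \<open>gh\<close>.\<close>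
    by (intro bexI[of _ "(g, h)"] bexI[of _ "\<one>\<^bsub>G\<^esub>"])
      (auto simp: weight_nonzero_iff triangle_def)
qed (use K.field_axioms G.group_axioms weight_trans weight_nonzero_iff in
    \<open>auto simp: twist_closed weight_def\<close>)

end

section \<open>The semigroup of normalized factor sets as the set of all normalized twists\<close>

text \<open>One direction reads the symmetry off a representation, the other is the triangle
  representation. The latter lives on a different element type, which
  \<open>factor_set_in_pm\<close> bridges.\<close>

lemma pm'_iff:
  assumes "field K" "group G"
  shows "\<sigma> \<in> pm' K G \<longleftrightarrow> normalized_twist K G \<sigma> \<and> \<sigma> \<in> extensional (carrier G \<times> carrier G)"
proof
  assume \<sigma>: "\<sigma> \<in> pm' K G"
  then obtain R :: "('a, ('c, 'a) alg_expr) module" and \<Gamma>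
    where R: "unital_assoc_algebra K R" "partial_proj_rep K G R \<Gamma> \<sigma>"
    by (auto simp: pm'_def pm_def)
  show "normalized_twist K G \<sigma> \<and> \<sigma> \<in> extensional (carrier G \<times> carrier G)"
    using normalized_twist_of_rep[OF assms R] \<sigma> by (auto simp: pm'_def pm_def PiE_iff)
next
  assume \<sigma>: "normalized_twist K G \<sigma> \<and> \<sigma> \<in> extensional (carrier G \<times> carrier G)"
  then interpret normalized_twist K G \<sigma> by blast
  obtain R :: "('a, (('c \<times> 'c) \<times> 'c \<Rightarrow> 'a) \<Rightarrow> (('c \<times> 'c) \<times> 'c \<Rightarrow> 'a)) module" and \<Gamma>
    where "unital_assoc_algebra K R" "partial_proj_rep K G R \<Gamma> \<sigma>"
    using twist_rep by blast
  then have "\<sigma> \<in> pm K G" using factor_set_in_pm assms(2) \<sigma> by blast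
  then show "\<sigma> \<in> pm' K G" using twist_inv by (auto simp: pm'_def)
qed

lemma maps_monoid_mult [simp]:
  "p \<in> carrier G \<times> carrier G \<Longrightarrow> (\<sigma> \<otimes>\<^bsub>maps_monoid K G\<^esub> \<tau>) p = \<sigma> p \<otimes>\<^bsub>K\<^esub> \<tau> p"
  by (simp add: maps_monoid_def product_group_def)

text \<open>Every condition is multiplicative, since a product in a field is nonzero only where both
  factors are. With \<open>pm'_iff\<close> no representation has to be built for the
  product.\<close>

lemma normalized_twist_mult:
  assumes "normalized_twist K G \<sigma>" "normalized_twist K G \<tau>"
  shows "normalized_twist K G (\<sigma> \<otimes>\<^bsub>maps_monoid K G\<^esub> \<tau>)"
proof -
  interpret s: normalized_twist K G \<sigma> by (rule assms)
  interpret t: normalized_twist K G \<tau> by (rule assms)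
  have one: "(a \<otimes>\<^bsub>K\<^esub> b) \<otimes>\<^bsub>K\<^esub> (c \<otimes>\<^bsub>K\<^esub> d) = \<one>\<^bsub>K\<^esub>"
    if "a \<otimes>\<^bsub>K\<^esub> c = \<one>\<^bsub>K\<^esub>" "b \<otimes>\<^bsub>K\<^esub> d = \<one>\<^bsub>K\<^esub>"
      "a \<in> carrier K" "b \<in> carrier K" "c \<in> carrier K" "d \<in> carrier K" for a b c d
  proof -
    have "(a \<otimes>\<^bsub>K\<^esub> b) \<otimes>\<^bsub>K\<^esub> (c \<otimes>\<^bsub>K\<^esub> d) = (a \<otimes>\<^bsub>K\<^esub> c) \<otimes>\<^bsub>K\<^esub> (b \<otimes>\<^bsub>K\<^esub> d)"
      using that(3-6) by (simp add: s.K.m_ac)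
    then show ?thesis using that(1,2) by simp
  qed
  show ?thesis
  proof unfold_locales
    fix g assume "g \<in> carrier G"
    then show "(\<sigma> \<otimes>\<^bsub>maps_monoid K G\<^esub> \<tau>) (g, inv\<^bsub>G\<^esub> g) \<in> {\<zero>\<^bsub>K\<^esub>, \<one>\<^bsub>K\<^esub>}"
      using s.twist_inv[of g] t.twist_inv[of g] by auto
  next
    fix g h assume gh: "g \<in> carrier G" "h \<in> carrier G"
      and "(\<sigma> \<otimes>\<^bsub>maps_monoid K G\<^esub> \<tau>) (g, h) \<noteq> \<zero>\<^bsub>K\<^esub>"
    then have "\<sigma> (g, h) \<noteq> \<zero>\<^bsub>K\<^esub>" "\<tau> (g, h) \<noteq> \<zero>\<^bsub>K\<^esub>"
      by (auto simp: s.twist_closed t.twist_closed)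
    note nz = gh this
    show "(\<sigma> \<otimes>\<^bsub>maps_monoid K G\<^esub> \<tau>) (g, inv\<^bsub>G\<^esub> g) = \<one>\<^bsub>K\<^esub>"
      using nz s.twist_supp_left[of g h] t.twist_supp_left[of g h] by simp
    show "(\<sigma> \<otimes>\<^bsub>maps_monoid K G\<^esub> \<tau>) (h, inv\<^bsub>G\<^esub> h) = \<one>\<^bsub>K\<^esub>"
      using nz s.twist_supp_right[of g h] t.twist_supp_right[of g h] by simp
    show "(\<sigma> \<otimes>\<^bsub>maps_monoid K G\<^esub> \<tau>) (g, h) \<otimes>\<^bsub>K\<^esub> (\<sigma> \<otimes>\<^bsub>maps_monoid K G\<^esub> \<tau>) (inv\<^bsub>G\<^esub> g, g \<otimes>\<^bsub>G\<^esub> h) = \<one>\<^bsub>K\<^esub>"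
      using nz s.twist_left[of g h] t.twist_left[of g h]
      by (simp add: one s.twist_closed t.twist_closed)
    show "(\<sigma> \<otimes>\<^bsub>maps_monoid K G\<^esub> \<tau>) (g, h) \<otimes>\<^bsub>K\<^esub> (\<sigma> \<otimes>\<^bsub>maps_monoid K G\<^esub> \<tau>) (g \<otimes>\<^bsub>G\<^esub> h, inv\<^bsub>G\<^esub> h) = \<one>\<^bsub>K\<^esub>"
      using nz s.twist_right[of g h] t.twist_right[of g h]
      by (simp add: one s.twist_closed t.twist_closed)
  qed (simp_all add: s.twist_closed t.twist_closed s.twist_one t.twist_one)
qed

section \<open>The infinite dihedral group\<close>

lemma mem_nu_index [simp]: "Inl i \<in> nu_index \<longleftrightarrow> i \<ge> 1" "Inr i \<in> nu_index"
  by (auto simp: nu_index_def)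

lemma mem_S_nu:
  "(e, i) \<in> S_nu \<nu> \<longleftrightarrow> (if e then \<nu> (Inr i) = 0 else i \<noteq> 0 \<and> \<nu> (Inl \<bar>i\<bar>) = 0)"
proof (cases e)
  case False
  have "(False, i) \<in> S_nu \<nu> \<longleftrightarrow> (\<exists>j\<ge>1. \<nu> (Inl j) = 0 \<and> (i = j \<or> i = - j))"
    by (auto simp: S_nu_def da_pow db_def)
  also have "\<dots> \<longleftrightarrow> i \<noteq> 0 \<and> \<nu> (Inl \<bar>i\<bar>) = 0"
    by (auto intro!: exI[of _ "\<bar>i\<bar>"])
  finally show ?thesis using False by simp
qed (auto simp: S_nu_def da_pow db_def)

lemma inv_mem_S_nu: "inv\<^bsub>D_inf\<^esub> x \<in> S_nu \<nu> \<longleftrightarrow> x \<in> S_nu \<nu>"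
  by (cases x) (auto simp: mem_S_nu)

lemma one_notin_S_nu: "\<one>\<^bsub>D_inf\<^esub> \<notin> S_nu \<nu>"
  by (simp add: mem_S_nu)

text \<open>A \<open>{0, 1}\<close>-valued family is determined by its zeros, and distinct indices
  contribute disjoint sets of the form \<open>{g, inv g}\<close> to \<open>S_nu\<close>.\<close>

lemma S_nu_eq_iff:
  assumes "\<nu> \<in> carrier nu_semigroup" "\<nu>' \<in> carrier nu_semigroup"
  shows "S_nu \<nu> = S_nu \<nu>' \<longleftrightarrow> \<nu> = \<nu>'"
proof
  assume eq: "S_nu \<nu> = S_nu \<nu>'"
  show "\<nu> = \<nu>'"
  proof (rule extensionalityI[of _ nu_index])
    fix r assume r: "r \<in> nu_index"
    have mem: "x \<in> S_nu \<nu> \<longleftrightarrow> x \<in> S_nu \<nu>'" for x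
      by (simp only: eq)
    have "\<nu> r = 0 \<longleftrightarrow> \<nu>' r = 0"
    proof (cases r)
      case (Inl i)
      then have "i \<ge> 1" using r by simp
      then show ?thesis
        using mem[of "(False, i)"] unfolding mem_S_nu Inl by simp
    next
      case (Inr i)
      then show ?thesis
        using mem[of "(True, i)"] unfolding mem_S_nu Inr by simp
    qed
    moreover have "\<nu> r \<in> {0, 1}" "\<nu>' r \<in> {0, 1}"
      using assms r unfolding nu_semigroup_def zero_one_def carrier_product_group by auto
    ultimately show "\<nu> r = \<nu>' r" by auto
  qed (use assms in \<open>auto simp: nu_semigroup_def PiE_iff\<close>)
qed simp

section \<open>The two parametrized families as normalized twists\<close>

lemma sigma_nu_eq_zero_iff:
  assumes "field K"
  shows "sigma_nu K \<nu> (x, y) = \<zero>\<^bsub>K\<^esub> \<longleftrightarrow> x \<in> S_nu \<nu> \<or> y \<in> S_nu \<nu> \<or> x \<otimes>\<^bsub>D_inf\<^esub> y \<in> S_nu \<nu>"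
proof -
  interpret K: field K by (rule assms)
  show ?thesis by (auto simp: sigma_nu_def)
qed

lemma sigma_nu_nonzero: "sigma_nu K \<nu> p \<noteq> \<zero>\<^bsub>K\<^esub> \<Longrightarrow> sigma_nu K \<nu> p = \<one>\<^bsub>K\<^esub>"
  by (auto simp: sigma_nu_def split: prod.splits if_splits)

text \<open>Up to inverses, \<open>{x, y, xy}\<close> is the same set for a pair and for both of its
  partners, and \<open>S_nu\<close> is closed under inverses and omits the identity.\<close>

lemma sigma_nu_twist:
  assumes "field K"
  shows "normalized_twist K D_inf (sigma_nu K \<nu>)"
proof -
  interpret K: field K by (rule assms)
  have cancel: "inv\<^bsub>D_inf\<^esub> x \<otimes>\<^bsub>D_inf\<^esub> (x \<otimes>\<^bsub>D_inf\<^esub> y) = y"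
    "(x \<otimes>\<^bsub>D_inf\<^esub> y) \<otimes>\<^bsub>D_inf\<^esub> inv\<^bsub>D_inf\<^esub> y = x" for x y
    by (cases x; cases y; simp)+
  note [simp del] = one_D_inf
  show ?thesis
    by unfold_locales
      (auto simp: sigma_nu_def cancel inv_mem_S_nu one_notin_S_nu split: if_splits)
qed

text \<open>\<open>C_pos\<close> collects the rotations of a pair and \<open>C_neg\<close> its
  reflections; each of the two generating involutions is a reflection and exchanges them.\<close>

lemma C_left:
  "(x, y) \<in> C_pos p \<Longrightarrow> (inv\<^bsub>D_inf\<^esub> x, x \<otimes>\<^bsub>D_inf\<^esub> y) \<in> C_neg p"
  "(x, y) \<in> C_neg p \<Longrightarrow> (inv\<^bsub>D_inf\<^esub> x, x \<otimes>\<^bsub>D_inf\<^esub> y) \<in> C_pos p"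
  and C_right:
  "(x, y) \<in> C_pos p \<Longrightarrow> (x \<otimes>\<^bsub>D_inf\<^esub> y, inv\<^bsub>D_inf\<^esub> y) \<in> C_neg p"
  "(x, y) \<in> C_neg p \<Longrightarrow> (x \<otimes>\<^bsub>D_inf\<^esub> y, inv\<^bsub>D_inf\<^esub> y) \<in> C_pos p"
  by (cases x; cases y; cases p; cases "fst p"; cases "snd p";
      auto simp: C_pos_def C_neg_def split: if_splits)+

lemma sigma_omega_closed:
  assumes "field K" "\<omega> \<in> carrier (omega_semigroup K)"
  shows "sigma_omega K \<omega> p \<in> carrier K"
proof -
  interpret K: field K by (rule assms)
  have \<omega>: "\<omega> r \<in> carrier K" if "r \<in> omega_index" for r
    using assms that by (auto simp: omega_semigroup_def)
  obtain x y where p: "p = (x, y)" by (cases p)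
  show ?thesis
  proof (cases x y rule: pair_cases)
    case trivial
    then show ?thesis by (simp only: p sigma_omega_trivial K.one_closed)
  next
    case (pos r)
    then show ?thesis by (simp add: p sigma_omega_pos \<omega>)
  next
    case (neg r)
    then show ?thesis using \<omega>[of r] K.field_Units by (auto simp: p sigma_omega_neg)
  qed
qed

text \<open>Both involutions permute the trivial pairs and otherwise move to the other half of the
  same orbit, where \<open>sigma_omega\<close> was defined by the inverse value. The support
  conditions hold because the value at \<open>(x, inv x)\<close> is always one.\<close>

lemma sigma_omega_twist:
  assumes "field K" "\<omega> \<in> carrier (omega_semigroup K)"
  shows "normalized_twist K D_inf (sigma_omega K \<omega>)"
proof -
  interpret K: field K by (rule assms)
  note [simp del] = one_D_inf
  have \<omega>: "\<omega> r \<in> carrier K" if "r \<in> omega_index" for r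
    using assms that by (auto simp: omega_semigroup_def)
  have main: "sigma_omega K \<omega> (x, y) \<otimes>\<^bsub>K\<^esub> sigma_omega K \<omega> (inv\<^bsub>D_inf\<^esub> x, x \<otimes>\<^bsub>D_inf\<^esub> y) = \<one>\<^bsub>K\<^esub>"
    "sigma_omega K \<omega> (x, y) \<otimes>\<^bsub>K\<^esub> sigma_omega K \<omega> (x \<otimes>\<^bsub>D_inf\<^esub> y, inv\<^bsub>D_inf\<^esub> y) = \<one>\<^bsub>K\<^esub>"
    if nz: "sigma_omega K \<omega> (x, y) \<noteq> \<zero>\<^bsub>K\<^esub>" for x y
  proof (atomize (full), cases x y rule: pair_cases)
    case trivial
    have "sigma_omega K \<omega> (x, y) = \<one>\<^bsub>K\<^esub>"
      "sigma_omega K \<omega> (inv\<^bsub>D_inf\<^esub> x, x \<otimes>\<^bsub>D_inf\<^esub> y) = \<one>\<^bsub>K\<^esub>"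
      "sigma_omega K \<omega> (x \<otimes>\<^bsub>D_inf\<^esub> y, inv\<^bsub>D_inf\<^esub> y) = \<one>\<^bsub>K\<^esub>"
      using trivial by (auto intro!: sigma_omega_trivial)
    then show "sigma_omega K \<omega> (x, y) \<otimes>\<^bsub>K\<^esub> sigma_omega K \<omega> (inv\<^bsub>D_inf\<^esub> x, x \<otimes>\<^bsub>D_inf\<^esub> y) = \<one>\<^bsub>K\<^esub> \<and>
      sigma_omega K \<omega> (x, y) \<otimes>\<^bsub>K\<^esub> sigma_omega K \<omega> (x \<otimes>\<^bsub>D_inf\<^esub> y, inv\<^bsub>D_inf\<^esub> y) = \<one>\<^bsub>K\<^esub>" by simp
  next
    case (pos r)
    then have "\<omega> r \<in> Units K" using nz \<omega>[of r] K.field_Units by (auto simp: sigma_omega_pos)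
    with pos nz show "sigma_omega K \<omega> (x, y) \<otimes>\<^bsub>K\<^esub> sigma_omega K \<omega> (inv\<^bsub>D_inf\<^esub> x, x \<otimes>\<^bsub>D_inf\<^esub> y) = \<one>\<^bsub>K\<^esub> \<and>
      sigma_omega K \<omega> (x, y) \<otimes>\<^bsub>K\<^esub> sigma_omega K \<omega> (x \<otimes>\<^bsub>D_inf\<^esub> y, inv\<^bsub>D_inf\<^esub> y) = \<one>\<^bsub>K\<^esub>"
      by (simp add: sigma_omega_pos sigma_omega_neg[OF pos(1)] C_left C_right)
  next
    case (neg r)
    then have "\<omega> r \<in> Units K" "\<omega> r \<noteq> \<zero>\<^bsub>K\<^esub>"
      using nz \<omega>[of r] K.field_Units by (auto simp: sigma_omega_neg split: if_splits)
    with neg nz show "sigma_omega K \<omega> (x, y) \<otimes>\<^bsub>K\<^esub> sigma_omega K \<omega> (inv\<^bsub>D_inf\<^esub> x, x \<otimes>\<^bsub>D_inf\<^esub> y) = \<one>\<^bsub>K\<^esub> \<and>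
      sigma_omega K \<omega> (x, y) \<otimes>\<^bsub>K\<^esub> sigma_omega K \<omega> (x \<otimes>\<^bsub>D_inf\<^esub> y, inv\<^bsub>D_inf\<^esub> y) = \<one>\<^bsub>K\<^esub>"
      by (simp add: sigma_omega_neg sigma_omega_pos[OF neg(1)] C_left C_right)
  qed
  have "sigma_omega K \<omega> (x, inv\<^bsub>D_inf\<^esub> x) = \<one>\<^bsub>K\<^esub>" for x
    by (rule sigma_omega_trivial) simp
  moreover have "sigma_omega K \<omega> (\<one>\<^bsub>D_inf\<^esub>, \<one>\<^bsub>D_inf\<^esub>) = \<one>\<^bsub>K\<^esub>"
    by (rule sigma_omega_trivial) simp
  ultimately show ?thesis
    by unfold_locales (simp_all add: main sigma_omega_closed[OF assms])
qed

section \<open>Multiplicativity in the parameters\<close>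

text \<open>A product of numbers vanishes iff a factor does, so products of families become unions
  of the sets \<open>S_nu\<close>.\<close>

lemma sigma_nu_mult:
  assumes "field K"
  shows "sigma_nu K (\<nu> \<otimes>\<^bsub>nu_semigroup\<^esub> \<nu>') p = sigma_nu K \<nu> p \<otimes>\<^bsub>K\<^esub> sigma_nu K \<nu>' p"
proof -
  interpret K: field K by (rule assms)
  have "(\<nu> \<otimes>\<^bsub>nu_semigroup\<^esub> \<nu>') r = \<nu> r * \<nu>' r" if "r \<in> nu_index" for r
    using that by (simp add: nu_semigroup_def product_group_def zero_one_def)
  then have "x \<in> S_nu (\<nu> \<otimes>\<^bsub>nu_semigroup\<^esub> \<nu>') \<longleftrightarrow> x \<in> S_nu \<nu> \<or> x \<in> S_nu \<nu>'" for x
    by (cases x) (auto simp: mem_S_nu)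
  then show ?thesis by (auto simp: sigma_nu_def split: prod.splits)
qed

text \<open>Inversion on \<open>K\<close>, extended by sending zero to zero, is multiplicative; this
  covers the \<open>C_neg\<close> half of each orbit.\<close>

lemma sigma_omega_mult:
  assumes "field K" and \<omega>: "\<omega> \<in> carrier (omega_semigroup K)" "\<omega>' \<in> carrier (omega_semigroup K)"
  shows "sigma_omega K (\<omega> \<otimes>\<^bsub>omega_semigroup K\<^esub> \<omega>') p = sigma_omega K \<omega> p \<otimes>\<^bsub>K\<^esub> sigma_omega K \<omega>' p"
proof -
  interpret K: field K by (rule assms)
  have \<omega>_mult: "(\<omega> \<otimes>\<^bsub>omega_semigroup K\<^esub> \<omega>') r = \<omega> r \<otimes>\<^bsub>K\<^esub> \<omega>' r" if "r \<in> omega_index" for r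
    using that by (simp add: omega_semigroup_def product_group_def)
  have \<omega>_K: "\<omega> r \<in> carrier K" "\<omega>' r \<in> carrier K" if "r \<in> omega_index" for r
    using \<omega> that by (auto simp: omega_semigroup_def)
  have inv: "inv\<^bsub>K\<^esub> (c \<otimes>\<^bsub>K\<^esub> d) = inv\<^bsub>K\<^esub> c \<otimes>\<^bsub>K\<^esub> inv\<^bsub>K\<^esub> d" if "c \<in> Units K" "d \<in> Units K" for c d
  proof (rule K.comm_inv_char)
    have "c \<otimes>\<^bsub>K\<^esub> d \<otimes>\<^bsub>K\<^esub> (inv\<^bsub>K\<^esub> c \<otimes>\<^bsub>K\<^esub> inv\<^bsub>K\<^esub> d) = (c \<otimes>\<^bsub>K\<^esub> inv\<^bsub>K\<^esub> c) \<otimes>\<^bsub>K\<^esub> (d \<otimes>\<^bsub>K\<^esub> inv\<^bsub>K\<^esub> d)"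
      using that K.Units_inv_closed by (simp only: K.m_ac K.Units_closed K.m_closed)
    then show "c \<otimes>\<^bsub>K\<^esub> d \<otimes>\<^bsub>K\<^esub> (inv\<^bsub>K\<^esub> c \<otimes>\<^bsub>K\<^esub> inv\<^bsub>K\<^esub> d) = \<one>\<^bsub>K\<^esub>" using that by simp
  qed (use that in auto)
  obtain x y where p: "p = (x, y)" by (cases p)
  show ?thesis
  proof (cases x y rule: pair_cases)
    case trivial
    then show ?thesis by (simp only: p sigma_omega_trivial K.one_closed K.l_one)
  next
    case (pos r)
    then show ?thesis by (simp add: p sigma_omega_pos \<omega>_mult)
  next
    case (neg r)
    have "c \<in> Units K" if "c \<in> carrier K" "c \<noteq> \<zero>\<^bsub>K\<^esub>" for c
      using that K.field_Units by auto
    with neg \<omega>_K[of r] show ?thesis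
      by (simp add: p sigma_omega_neg \<omega>_mult inv K.integral_iff)
  qed
qed

section \<open>Recovering a twist from its values at the representatives\<close>

lemma twist_C_pos:
  assumes "normalized_twist K D_inf \<sigma>" "p \<in> C_pos q"
  shows "\<sigma> p = \<sigma> q"
proof -
  interpret normalized_twist K D_inf \<sigma> by (rule assms)
  obtain x y where q: "q = (x, y)" by (cases q)
  show ?thesis
    using assms(2) twist_rotate[of x y] twist_rotate'[of x y]
    by (auto simp: C_pos_def q D.inv_mult_group)
qed

lemma twist_C_neg:
  assumes "normalized_twist K D_inf \<sigma>" "p \<in> C_neg q"
  shows "\<sigma> p = (if \<sigma> q = \<zero>\<^bsub>K\<^esub> then \<zero>\<^bsub>K\<^esub> else inv\<^bsub>K\<^esub> (\<sigma> q))"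
proof -
  interpret normalized_twist K D_inf \<sigma> by (rule assms)
  obtain x y where q: "q = (x, y)" by (cases q)
  \<comment> \<open>The third reflection is the left involution applied to the rotated pair
    \<open>(y, inv (xy))\<close>; the other two are the left and right partners of
    \<open>(x, y)\<close>.\<close>
  have "\<sigma> (inv\<^bsub>D_inf\<^esub> y, inv\<^bsub>D_inf\<^esub> x) = (if \<sigma> (x, y) = \<zero>\<^bsub>K\<^esub> then \<zero>\<^bsub>K\<^esub> else inv\<^bsub>K\<^esub> (\<sigma> (x, y)))"
    using twist_left_eq[of y "inv\<^bsub>D_inf\<^esub> (x \<otimes>\<^bsub>D_inf\<^esub> y)"] twist_rotate'[of x y]
    by (simp add: D.inv_mult_group cancel_left)
  then show ?thesis
    using assms(2) twist_left_eq[of x y] twist_right_eq[of x y]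
    by (auto simp: C_neg_def q)
qed

text \<open>Two functions with the same symmetry agree on an orbit once they agree at its
  representative; on trivial pairs, liveness makes both equal to one.\<close>

lemma twist_eq_sigma_omega:
  assumes \<sigma>: "normalized_twist K D_inf \<sigma>" and p: "sigma_nu K \<nu> p \<noteq> \<zero>\<^bsub>K\<^esub>"
    and S: "\<And>g. g \<in> S_nu \<nu> \<longleftrightarrow> \<sigma> (g, inv\<^bsub>D_inf\<^esub> g) = \<zero>\<^bsub>K\<^esub>"
    and \<omega>: "\<And>r. \<lbrakk>r \<in> omega_index; sigma_nu K \<nu> (rep_pair r) \<noteq> \<zero>\<^bsub>K\<^esub>\<rbrakk> \<Longrightarrow> \<omega> r = \<sigma> (rep_pair r)"
  shows "\<sigma> p = sigma_omega K \<omega> p"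
proof -
  interpret normalized_twist K D_inf \<sigma> by (rule \<sigma>)
  \<comment> \<open>\<open>sigma_nu\<close> is itself a twist, so its support is a union of orbits,
    and nonvanishing passes from \<open>p\<close> to the representative.\<close>
  note nu = sigma_nu_twist[OF K.field_axioms, of \<nu>]
  note [simp del] = one_D_inf
  obtain x y where xy: "p = (x, y)" by (cases p)
  show ?thesis
  proof (cases x y rule: pair_cases)
    case trivial
    have live: "\<sigma> (x, inv\<^bsub>D_inf\<^esub> x) = \<one>\<^bsub>K\<^esub>" "\<sigma> (y, inv\<^bsub>D_inf\<^esub> y) = \<one>\<^bsub>K\<^esub>"
      using p S twist_inv[of x] twist_inv[of y]
      by (auto simp: xy sigma_nu_eq_zero_iff[OF K.field_axioms])
    have "y = inv\<^bsub>D_inf\<^esub> x" if "x \<otimes>\<^bsub>D_inf\<^esub> y = \<one>\<^bsub>D_inf\<^esub>"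
      using that by (metis D.inv_equality D.inv_comm carrier_D_inf UNIV_I)
    then have "\<sigma> (x, y) = \<one>\<^bsub>K\<^esub>"
      using trivial live(1) twist_trivial[OF _ live(1)] twist_trivial[OF _ live(2)] by auto
    then show ?thesis unfolding xy sigma_omega_trivial[OF trivial] .
  next
    case (pos r)
    then have "\<sigma> p = \<sigma> (rep_pair r)" "sigma_nu K \<nu> (rep_pair r) \<noteq> \<zero>\<^bsub>K\<^esub>"
      using twist_C_pos[OF \<sigma>] twist_C_pos[OF nu] p by (auto simp: xy)
    then show ?thesis using pos \<omega> by (simp add: xy sigma_omega_pos)
  next
    case (neg r)
    then have "sigma_nu K \<nu> (rep_pair r) \<noteq> \<zero>\<^bsub>K\<^esub>"
      using twist_C_neg[OF nu, of p "rep_pair r"] p by (auto simp: xy)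
    then show ?thesis using neg \<omega> twist_C_neg[OF \<sigma>, of p "rep_pair r"] by (simp add: xy sigma_omega_neg)
  qed
qed

text \<open>The family \<open>\<nu>\<close> records which group elements are live, and
  \<open>\<omega>\<close> the values of \<open>\<sigma>\<close> at the representatives.\<close>

lemma twist_decomposes:
  assumes \<sigma>: "normalized_twist K D_inf \<sigma>"
  shows "\<exists>\<nu>\<in>carrier nu_semigroup. \<exists>\<omega>\<in>carrier (omega_semigroup K). decomposes K \<sigma> \<nu> \<omega>"
proof -
  interpret normalized_twist K D_inf \<sigma> by (rule \<sigma>)
  define \<nu> where "\<nu> = (\<lambda>r\<in>nu_index. case r of
      Inl i \<Rightarrow> if \<sigma> ((False, i), (False, - i)) = \<zero>\<^bsub>K\<^esub> then 0 else 1
    | Inr i \<Rightarrow> if \<sigma> ((True, i), (True, i)) = \<zero>\<^bsub>K\<^esub> then 0 else (1 :: nat))"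
  \<comment> \<open>The default value one, where \<open>sigma_nu\<close> vanishes, makes the null
    sets disjoint.\<close>
  define \<omega> where "\<omega> = (\<lambda>r\<in>omega_index. if sigma_nu K \<nu> (rep_pair r) = \<zero>\<^bsub>K\<^esub> then \<one>\<^bsub>K\<^esub> else \<sigma> (rep_pair r))"
  have \<nu>: "\<nu> \<in> carrier nu_semigroup"
    by (auto simp: \<nu>_def nu_semigroup_def zero_one_def split: sum.splits)
  have S: "g \<in> S_nu \<nu> \<longleftrightarrow> \<sigma> (g, inv\<^bsub>D_inf\<^esub> g) = \<zero>\<^bsub>K\<^esub>" for g
  proof -
    have nuL: "\<nu> (Inl i) = 0 \<longleftrightarrow> \<sigma> ((False, i), (False, - i)) = \<zero>\<^bsub>K\<^esub>" if "i > 0" for i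
      using that by (simp add: \<nu>_def)
    have nuR: "\<nu> (Inr i) = 0 \<longleftrightarrow> \<sigma> ((True, i), (True, i)) = \<zero>\<^bsub>K\<^esub>" for i
      by (simp add: \<nu>_def)
    obtain e i where g: "g = (e, i)" by (cases g)
    show ?thesis
      using twist_inv_commute[of g] twist_one nuL[of i] nuL[of "- i"] nuR[of i]
      by (cases e; cases "i < 0"; cases "i = 0") (auto simp: g mem_S_nu)
  qed
  have \<omega>_eq: "\<omega> r = \<sigma> (rep_pair r)" if "r \<in> omega_index" "sigma_nu K \<nu> (rep_pair r) \<noteq> \<zero>\<^bsub>K\<^esub>" for r
    using that by (simp add: \<omega>_def)
  have closed: "\<sigma> p \<in> carrier K" for p using twist_closed[of "fst p" "snd p"] by simp
  then have \<omega>: "\<omega> \<in> carrier (omega_semigroup K)"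
    by (auto simp: \<omega>_def omega_semigroup_def)
  note nu = sigma_nu_twist[OF K.field_axioms, of \<nu>]
  note om = sigma_omega_twist[OF K.field_axioms \<omega>]
  have "\<sigma> p = sigma_nu K \<nu> p \<otimes>\<^bsub>K\<^esub> sigma_omega K \<omega> p" for p
  proof (cases "sigma_nu K \<nu> p = \<zero>\<^bsub>K\<^esub>")
    case True
    obtain x y where p: "p = (x, y)" by (cases p)
    \<comment> \<open>A nonzero value would make \<open>x\<close>, \<open>y\<close> and
      \<open>xy\<close> live, so none of them could lie in \<open>S_nu\<close>.\<close>
    have "\<sigma> p = \<zero>\<^bsub>K\<^esub>"
    proof (rule ccontr)
      assume "\<sigma> p \<noteq> \<zero>\<^bsub>K\<^esub>"
      then show False
        using True S twist_supp_left[of x y] twist_supp_right[of x y] twist_supp_mult[of x y]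
        by (auto simp: p sigma_nu_eq_zero_iff[OF K.field_axioms])
    qed
    then show ?thesis using True by (simp add: sigma_omega_closed[OF K.field_axioms \<omega>])
  next
    case False
    then show ?thesis
      using twist_eq_sigma_omega[OF \<sigma> False S \<omega>_eq] sigma_nu_nonzero[OF False]
      by (simp add: sigma_omega_closed[OF K.field_axioms \<omega>])
  qed
  then have "\<sigma> = sigma_nu K \<nu> \<otimes>\<^bsub>maps_monoid K D_inf\<^esub> sigma_omega K \<omega>"
    by (simp add: fun_eq_iff)
  moreover have "sigma_omega K \<omega> p \<noteq> \<zero>\<^bsub>K\<^esub>" if z: "sigma_nu K \<nu> p = \<zero>\<^bsub>K\<^esub>" for p
  proof -
    obtain x y where p: "p = (x, y)" by (cases p)
    show ?thesis
    proof (cases x y rule: pair_cases)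
      case trivial
      show ?thesis unfolding p sigma_omega_trivial[OF trivial] by simp
    next
      case (pos r)
      then show ?thesis
        using twist_C_pos[OF nu, of p] z by (simp add: p sigma_omega_pos \<omega>_def)
    next
      case (neg r)
      have "sigma_nu K \<nu> (rep_pair r) = \<zero>\<^bsub>K\<^esub>"
        using twist_C_neg[OF nu, of p "rep_pair r"] sigma_nu_nonzero[of K \<nu> "rep_pair r"] z neg
        by (auto simp: p split: if_splits)
      then show ?thesis using neg by (simp add: p sigma_omega_neg \<omega>_def)
    qed
  qed
  then have "Null K D_inf (sigma_nu K \<nu>) \<inter> Null K D_inf (sigma_omega K \<omega>) = {}"
    by (auto simp: Null_def)
  ultimately show ?thesis using \<nu> \<omega> unfolding decomposes_def by blast
qed

section \<open>Uniqueness of the parameters\<close>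

text \<open>At the pairs \<open>(g, 1)\<close> the factor \<open>sigma_omega\<close> is one, so
  \<open>\<sigma>\<close> shows \<open>sigma_nu\<close> undisturbed. Hence \<open>\<sigma>\<close>
  determines \<open>S_nu\<close>.\<close>

lemma decomposes_S_nu:
  assumes "field K" "decomposes K \<sigma> \<nu> \<omega>"
  shows "S_nu \<nu> = {g. \<sigma> (g, \<one>\<^bsub>D_inf\<^esub>) = \<zero>\<^bsub>K\<^esub>}"
proof -
  interpret K: field K by (rule assms)
  have "sigma_omega K \<omega> (g, \<one>\<^bsub>D_inf\<^esub>) = \<one>\<^bsub>K\<^esub>" for g
    by (rule sigma_omega_trivial) simp
  moreover have "sigma_nu K \<nu> (g, \<one>\<^bsub>D_inf\<^esub>) = (if g \<in> S_nu \<nu> then \<zero>\<^bsub>K\<^esub> else \<one>\<^bsub>K\<^esub>)" for g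
    using one_notin_S_nu[of \<nu>] D.r_one[of g] by (simp add: sigma_nu_def del: one_D_inf)
  ultimately show ?thesis
    using assms(2) by (auto simp: decomposes_def simp del: one_D_inf)
qed

text \<open>At such a representative \<open>sigma_nu\<close> is one, so the product shows
  \<open>sigma_omega\<close>, whose value there is the parameter itself.\<close>

lemma decomposes_omega:
  assumes "field K" "decomposes K \<sigma> \<nu> \<omega>" "\<omega> \<in> carrier (omega_semigroup K)"
    and r: "r \<in> omega_index" "rep_pair r \<notin> Null K D_inf (sigma_nu K \<nu>)"
  shows "\<omega> r = \<sigma> (rep_pair r)"
proof -
  interpret K: field K by (rule assms)
  have "sigma_nu K \<nu> (rep_pair r) = \<one>\<^bsub>K\<^esub>"
    using r sigma_nu_nonzero by (fastforce simp: Null_def)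
  moreover have "rep_pair r \<in> C_pos (rep_pair r)"
    by (auto simp: C_pos_def split: prod.splits)
  then have "sigma_omega K \<omega> (rep_pair r) = \<omega> r" using r sigma_omega_pos by blast
  ultimately show ?thesis
    using assms r by (auto simp: decomposes_def omega_semigroup_def PiE_iff)
qed

text \<open>Uniqueness of \<open>\<omega>\<close> is asserted at the representatives where
  \<open>sigma_nu\<close> does not vanish; by \<open>omega_not_unique\<close>,
  \<open>\<omega>\<close> as a whole is not determined once \<open>K\<close> has an element other
  than zero and one.\<close>

theorem theorem10p12:
  fixes K :: "('k, 'm) ring_scheme"
  assumes "field K"
  shows "(\<exists>\<phi>. \<phi> \<in> epi (nu_semigroup \<times>\<times> omega_semigroup K) (pm'_semigroup K D_inf)) \<and>
    (\<forall>\<sigma>\<in>pm' K D_inf.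
       \<exists>\<nu>\<in>carrier nu_semigroup. \<exists>\<omega>\<in>carrier (omega_semigroup K).
         decomposes K \<sigma> \<nu> \<omega> \<and>
         (\<forall>\<nu>'\<in>carrier nu_semigroup. \<forall>\<omega>'\<in>carrier (omega_semigroup K).
            decomposes K \<sigma> \<nu>' \<omega>' \<longrightarrow>
              \<nu>' = \<nu> \<and>
              (\<forall>r\<in>omega_index. rep_pair r \<notin> Null K D_inf (sigma_nu K \<nu>) \<longrightarrow> \<omega>' r = \<omega> r)))"
proof -
  interpret K: field K by (rule assms)
  have pm': "\<sigma> \<in> pm' K D_inf \<longleftrightarrow> normalized_twist K D_inf \<sigma>" for \<sigma>
    by (simp add: pm'_iff[OF assms group_D_inf])
  define \<phi> where "\<phi> = (\<lambda>(\<nu>, \<omega>). sigma_nu K \<nu> \<otimes>\<^bsub>maps_monoid K D_inf\<^esub> sigma_omega K \<omega>)"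
  have \<phi>_pm': "\<phi> (\<nu>, \<omega>) \<in> pm' K D_inf" if "\<omega> \<in> carrier (omega_semigroup K)" for \<nu> \<omega>
    using normalized_twist_mult[OF sigma_nu_twist[OF assms] sigma_omega_twist[OF assms that]]
    by (simp add: pm' \<phi>_def)
  have "\<phi> (\<nu> \<otimes>\<^bsub>nu_semigroup\<^esub> \<nu>', \<omega> \<otimes>\<^bsub>omega_semigroup K\<^esub> \<omega>')
      = \<phi> (\<nu>, \<omega>) \<otimes>\<^bsub>maps_monoid K D_inf\<^esub> \<phi> (\<nu>', \<omega>')"
    if \<omega>: "\<omega> \<in> carrier (omega_semigroup K)" "\<omega>' \<in> carrier (omega_semigroup K)" for \<nu> \<nu>' \<omega> \<omega>'
  proof
    fix p
    have "sigma_nu K \<nu> p \<in> carrier K" for \<nu> by (auto simp: sigma_nu_def split: prod.splits)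
    then show "\<phi> (\<nu> \<otimes>\<^bsub>nu_semigroup\<^esub> \<nu>', \<omega> \<otimes>\<^bsub>omega_semigroup K\<^esub> \<omega>') p
        = (\<phi> (\<nu>, \<omega>) \<otimes>\<^bsub>maps_monoid K D_inf\<^esub> \<phi> (\<nu>', \<omega>')) p"
      using \<omega> by (simp add: \<phi>_def sigma_nu_mult sigma_omega_mult sigma_omega_closed assms K.m_ac)
  qed
  then have "\<phi> \<in> hom (nu_semigroup \<times>\<times> omega_semigroup K) (pm'_semigroup K D_inf)"
    using \<phi>_pm' by (auto simp: hom_def pm'_semigroup_def)
  \<comment> \<open>Surjectivity is the existence of decompositions, without the disjointness of the
    null sets.\<close>
  moreover have "pm' K D_inf \<subseteq> \<phi> ` carrier (nu_semigroup \<times>\<times> omega_semigroup K)"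
  proof
    fix \<sigma> assume "\<sigma> \<in> pm' K D_inf"
    then obtain \<nu> \<omega> where "\<nu> \<in> carrier nu_semigroup" "\<omega> \<in> carrier (omega_semigroup K)"
      "decomposes K \<sigma> \<nu> \<omega>"
      using twist_decomposes pm' by blast
    then show "\<sigma> \<in> \<phi> ` carrier (nu_semigroup \<times>\<times> omega_semigroup K)"
      by (intro image_eqI[of _ _ "(\<nu>, \<omega>)"]) (auto simp: \<phi>_def decomposes_def)
  qed
  ultimately have "\<phi> \<in> epi (nu_semigroup \<times>\<times> omega_semigroup K) (pm'_semigroup K D_inf)"
    by (auto simp: epi_def hom_def pm'_semigroup_def)
  moreover have "\<exists>\<nu>\<in>carrier nu_semigroup. \<exists>\<omega>\<in>carrier (omega_semigroup K).
      decomposes K \<sigma> \<nu> \<omega> \<and>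
      (\<forall>\<nu>'\<in>carrier nu_semigroup. \<forall>\<omega>'\<in>carrier (omega_semigroup K).
        decomposes K \<sigma> \<nu>' \<omega>' \<longrightarrow> \<nu>' = \<nu> \<and>
          (\<forall>r\<in>omega_index. rep_pair r \<notin> Null K D_inf (sigma_nu K \<nu>) \<longrightarrow> \<omega>' r = \<omega> r))"
    if \<sigma>: "\<sigma> \<in> pm' K D_inf" for \<sigma>
  proof -
    obtain \<nu> \<omega> where dec: "\<nu> \<in> carrier nu_semigroup" "\<omega> \<in> carrier (omega_semigroup K)"
      "decomposes K \<sigma> \<nu> \<omega>"
      using twist_decomposes \<sigma> pm' by blast
    \<comment> \<open>This comes first, so that \<open>\<omega>\<close> and \<open>\<omega>'\<close>
      are then compared outside one and the same null set.\<close>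
    have "\<nu>' = \<nu>" if "\<nu>' \<in> carrier nu_semigroup" "decomposes K \<sigma> \<nu>' \<omega>'" for \<nu>' \<omega>'
    proof -
      have "S_nu \<nu>' = S_nu \<nu>"
        unfolding decomposes_S_nu[OF assms dec(3)] decomposes_S_nu[OF assms that(2)] ..
      then show ?thesis using S_nu_eq_iff[OF that(1) dec(1)] by blast
    qed
    moreover have "\<omega>' r = \<omega> r"
      if "\<omega>' \<in> carrier (omega_semigroup K)" "decomposes K \<sigma> \<nu> \<omega>'" "r \<in> omega_index"
        "rep_pair r \<notin> Null K D_inf (sigma_nu K \<nu>)" for \<omega>' r
      using decomposes_omega[OF assms that(2,1,3,4)] decomposes_omega[OF assms dec(3,2) that(3,4)]
      by simp
    ultimately show ?thesis using dec by blast
  qed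
  ultimately show ?thesis by blast
qed

end
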